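(* In the single-target binary-tree search problem described in the context, let $f_l$ and $g_l$ be Bernoulli distributions with parameters (success probabilities) $\mu_l$ and $1-\mu_l$, respectively. Assume that $\mu_l=\frac12-\left(\frac12-\mu_0\right)\alpha^{-l}$ for $l=0,1,2,\ldots,\log_2 M$, for some $\alpha>1$ and $0<\mu_0<\frac12$. Then the Bayes risk of the IRW policy $\Gamma_{\mathrm{IRW}}$ is upper bounded by $$R(\Gamma_{\mathrm{IRW}})\le c\tilde B M^{\log_2\alpha^2}+\frac{c\log\frac{\log_2 M}{c}}{D(g_0\|f_0)}+O(c),$$ where $\tilde B$ is a constant independent of $c$ and $M$ (and the constant in $O(c)$ is independent of $c$ and $M$).
   Context: **Model.** There are $M=2^k$ processes ($k\ge1$), identified with the leaves of a complete binary tree; leaves are at level $0$ and the root at level $\log_2 M$. Exactly one leaf is the target (anomalous). Hypothesis $H_m$ ($m=1,\ldots,M$), with prior probability $\pi_m$, is that leaf $m$ is the target. At each time a node of the tree is probed, giving one observation, independent of the past given the probed node: a level-$l$ node yields an observation with distribution $g_l$ if its subtree contains the target, and $f_l$ otherwise. The distributions $g_l,f_l$ are known to the decision maker. $D(\cdot\|\cdot)$ is Kullback-Leibler divergence. $\log$ is the natural logarithm. **Strategies and risk.** A strategy $\Gamma=(\{\phi(t)\}_{t\ge1},\tau,\delta)$ consists of selection rules $\phi(t)$ (which node to probe at time $t$, based on past actions and observations), a stopping rule $\tau$ (total number of observations taken), and a declaration rule $\delta\in\{1,\ldots,M\}$ at stopping. Put $P_e(\Gamma)=\sum_m\pi_m\mathbb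 P_\Gamma[\delta\ne m\mid H_m]$, $Q(\Gamma)=\sum_m\pi_m\mathbb E_\Gamma[\tau\mid H_m]$, and, for sampling cost $c\in(0,1)$, the Bayes risk $R(\Gamma)=P_e(\Gamma)+cQ(\Gamma)$. **IRW policy (information-directed random walk).** Fix a confidence level $p\in(1/2,1)$. The policy performs a random walk on the nodes, starting at the root (the parent of the root is defined to be the root itself). - At a node of level $l>0$: take $K_l$ fresh samples from each of its two children, and compute for each child the sum log-likelihood ratio (SLLR) $\sum_{n=1}^{K_l}\log\frac{g_{l-1}(y(n))}{f_{l-1}(y(n))}$ of its samples. If both SLLRs are negative, move to the parent; otherwise move to the child with the larger SLLR. The sample sizes $K_l$ are design parameters, computed offline from $g_{l-1},f_{l-1}$, chosen suitably so as to ensure $p_l^{(g)}>p$ and $p_l^{(f)}>p$, where, with $Y_n$ i.i.d. $\sim g_{l-1}$ and $Z_n$ i.i.d. $\sim f_{l-1}$ (independent of each other), $$p_l^{(g)}=\Pr\Big[\sum_{n=1}^{K_l}\log\tfrac{g_{l-1}(Y_n)}{f_{l-1}(Y_n)}>\max\Big\{\sum_{n=1}^{K_l}\log\tfrac{g_{l-1}(Z_n)}{f_{l-1}(Z_n)},0\Big\}\Big],\quad p_l^{(f)}=\Big[\Pr\Big(\sum_{n=1}^{K_l}\log\tfrac{g_{l-1}(Z_n)}{f_{l-1}(Z_n)}<0\Big)\Big]^2 .$$ - At a leaf $m$: take samples one at a time from leaf $m$ and update $S_m(t)=\sum_{n=1}^t\log\frac{g_0(y(n))}{f_0(y(n))}$,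 using only samples taken during the current visit. When $S_m(t)$ drops below $0$, move to the parent of $m$. When $S_m(t)$ exceeds $\log\frac{\log_2 M}{c}$, stop and declare $m$ the target. *)

theory Defs
  imports "HOL-Probability.Probability"
begin

text \<open>
  The complete binary tree of height \<open>k\<close> has \<open>2 ^ k\<close> leaves. Node \<open>(l, i)\<close> is the \<open>i\<close>-th node of
  level \<open>l\<close>, counted from \<open>0\<close>; leaf \<open>m < 2 ^ k\<close> is \<open>(0, m)\<close> and the root is \<open>(k, 0)\<close>.
\<close>

type_synonym node = "nat \<times> nat"

definition tree_nodes :: "nat \<Rightarrow> node set" where
  "tree_nodes k = {(l, i). l \<le> k \<and> i < 2 ^ (k - l)}"

definition root_node :: "nat \<Rightarrow> node" where
  "root_node k = (k, 0)"

definition parent :: "nat \<Rightarrow> node \<Rightarrow> node" where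
  "parent k v = (if v = root_node k then v else (fst v + 1, snd v div 2))"

definition left_child :: "node \<Rightarrow> node" where
  "left_child v = (fst v - 1, 2 * snd v)"

definition right_child :: "node \<Rightarrow> node" where
  "right_child v = (fst v - 1, 2 * snd v + 1)"

text \<open>Leaf \<open>m\<close> lies below \<open>(l, i)\<close> iff its ancestor of level \<open>l\<close>, which has index \<open>m div 2 ^ l\<close>, is
  \<open>(l, i)\<close>.\<close>

definition in_subtree :: "nat \<Rightarrow> node \<Rightarrow> bool" where
  "in_subtree m v \<longleftrightarrow> m div 2 ^ fst v = snd v"

definition obs_pmf :: "(nat \<Rightarrow> 'o pmf) \<Rightarrow> (nat \<Rightarrow> 'o pmf) \<Rightarrow> nat \<Rightarrow> node \<Rightarrow> 'o pmf" where
  "obs_pmf g f m v = (if in_subtree m v then g (fst v) else f (fst v))"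

text \<open>
  Probability space under the hypothesis that \<open>m\<close> is the target: \<open>(\<omega> !! t) v\<close> is the observation
  that probing node \<open>v\<close> as the \<open>(t + 1)\<close>-st probe would give. All these variables are independent,
  and a strategy gets to see only the one at the node it probes.
\<close>

definition hyp_space ::
  "(nat \<Rightarrow> 'o pmf) \<Rightarrow> (nat \<Rightarrow> 'o pmf) \<Rightarrow> nat \<Rightarrow> nat \<Rightarrow> (node \<Rightarrow> 'o) stream measure" where
  "hyp_space g f k m =
     stream_space (measure_pmf (Pi_pmf (tree_nodes k) undefined (obs_pmf g f m)))"


text \<open>Histories list the past (probed node, observation) pairs, oldest first.\<close>

type_synonym 'o history = "(node \<times> 'o) list"

record 'o strategy =
  selection :: "'o history \<Rightarrow> node"
  stopping :: "'o history \<Rightarrow> bool"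
  decl :: "'o history \<Rightarrow> nat"

text \<open>The history is continued past the stopping time; only its part up to \<open>stop_time\<close> is used.\<close>

primrec run :: "'o strategy \<Rightarrow> (node \<Rightarrow> 'o) stream \<Rightarrow> nat \<Rightarrow> 'o history" where
  "run \<Gamma> \<omega> 0 = []"
| "run \<Gamma> \<omega> (Suc t) =
     (let h = run \<Gamma> \<omega> t; v = selection \<Gamma> h in h @ [(v, (\<omega> !! t) v)])"

definition stop_time :: "'o strategy \<Rightarrow> (node \<Rightarrow> 'o) stream \<Rightarrow> enat" where
  "stop_time \<Gamma> \<omega> = (INF t\<in>{t. stopping \<Gamma> (run \<Gamma> \<omega> t)}. enat t)"

text \<open>A run that never stops makes no declaration, so it counts as an error (and has infinite
  length).\<close>

definition declares :: "'o strategy \<Rightarrow> (node \<Rightarrow> 'o) stream \<Rightarrow> nat \<Rightarrow> bool" where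
  "declares \<Gamma> \<omega> m \<longleftrightarrow> (\<exists>t. stop_time \<Gamma> \<omega> = enat t \<and> decl \<Gamma> (run \<Gamma> \<omega> t) = m)"

definition error_prob ::
  "(nat \<Rightarrow> 'o pmf) \<Rightarrow> (nat \<Rightarrow> 'o pmf) \<Rightarrow> nat \<Rightarrow> nat pmf \<Rightarrow> 'o strategy \<Rightarrow> ennreal" where
  "error_prob g f k prior \<Gamma> =
     (\<Sum>m<2 ^ k. ennreal (pmf prior m) *
        emeasure (hyp_space g f k m) {\<omega> \<in> space (hyp_space g f k m). \<not> declares \<Gamma> \<omega> m})"

definition mean_samples ::
  "(nat \<Rightarrow> 'o pmf) \<Rightarrow> (nat \<Rightarrow> 'o pmf) \<Rightarrow> nat \<Rightarrow> nat pmf \<Rightarrow> 'o strategy \<Rightarrow> ennreal" where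
  "mean_samples g f k prior \<Gamma> =
     (\<Sum>m<2 ^ k. ennreal (pmf prior m) *
        (\<integral>\<^sup>+ \<omega>. ennreal_of_enat (stop_time \<Gamma> \<omega>) \<partial>hyp_space g f k m))"

definition bayes_risk ::
  "(nat \<Rightarrow> 'o pmf) \<Rightarrow> (nat \<Rightarrow> 'o pmf) \<Rightarrow> nat \<Rightarrow> nat pmf \<Rightarrow> real \<Rightarrow> 'o strategy \<Rightarrow> ennreal" where
  "bayes_risk g f k prior c \<Gamma> =
     error_prob g f k prior \<Gamma> + ennreal c * mean_samples g f k prior \<Gamma>"


definition sllr :: "'o pmf \<Rightarrow> 'o pmf \<Rightarrow> 'o list \<Rightarrow> real" where
  "sllr q r ys = (\<Sum>y\<leftarrow>ys. ln (pmf q y / pmf r y))"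

definition conf_g :: "'o pmf \<Rightarrow> 'o pmf \<Rightarrow> nat \<Rightarrow> real" where
  "conf_g q r n =
     measure_pmf.prob (pair_pmf (replicate_pmf n q) (replicate_pmf n r))
       {(ys, zs). sllr q r ys > max (sllr q r zs) 0}"

definition conf_f :: "'o pmf \<Rightarrow> 'o pmf \<Rightarrow> nat \<Rightarrow> real" where
  "conf_f q r n = (measure_pmf.prob (replicate_pmf n r) {zs. sllr q r zs < 0})\<^sup>2"

text \<open>
  A state of the random walk is the current node together with the observations made during the
  current visit to it, oldest first. At a node of level \<open>l > 0\<close> the first \<open>K l\<close> of them come from
  the left child and the next \<open>K l\<close> from the right child. If the two sums are equal and not
  negative, the walk moves to the left child iff \<open>tie v\<close>.
\<close>

definition irw_move ::
  "(nat \<Rightarrow> 'o pmf) \<Rightarrow> (nat \<Rightarrow> 'o pmf) \<Rightarrow> nat \<Rightarrow> (nat \<Rightarrow> nat) \<Rightarrow> (node \<Rightarrow> bool) \<Rightarrow>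
   node \<Rightarrow> 'o list \<Rightarrow> node" where
  "irw_move g f k K tie v ys =
     (let l = fst v;
          a = sllr (g (l - 1)) (f (l - 1)) (take (K l) ys);
          b = sllr (g (l - 1)) (f (l - 1)) (drop (K l) ys)
      in if a < 0 \<and> b < 0 then parent k v
         else if a > b \<or> a = b \<and> tie v then left_child v
         else right_child v)"

fun irw_step ::
  "(nat \<Rightarrow> 'o pmf) \<Rightarrow> (nat \<Rightarrow> 'o pmf) \<Rightarrow> nat \<Rightarrow> (nat \<Rightarrow> nat) \<Rightarrow> (node \<Rightarrow> bool) \<Rightarrow>
   node \<times> 'o list \<Rightarrow> 'o \<Rightarrow> node \<times> 'o list" where
  "irw_step g f k K tie (v, ys) y =
     (let ys' = ys @ [y] in
      if fst v > 0 then
        (if length ys' < 2 * K (fst v) then (v, ys') else (irw_move g f k K tie v ys', []))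
      else
        (if sllr (g 0) (f 0) ys' < 0 then (parent k v, []) else (v, ys')))"

definition irw_state ::
  "(nat \<Rightarrow> 'o pmf) \<Rightarrow> (nat \<Rightarrow> 'o pmf) \<Rightarrow> nat \<Rightarrow> (nat \<Rightarrow> nat) \<Rightarrow> (node \<Rightarrow> bool) \<Rightarrow>
   'o history \<Rightarrow> node \<times> 'o list" where
  "irw_state g f k K tie h = foldl (irw_step g f k K tie) (root_node k, []) (map snd h)"

definition irw ::
  "(nat \<Rightarrow> 'o pmf) \<Rightarrow> (nat \<Rightarrow> 'o pmf) \<Rightarrow> nat \<Rightarrow> (nat \<Rightarrow> nat) \<Rightarrow> (node \<Rightarrow> bool) \<Rightarrow> real \<Rightarrow>
   'o strategy" where
  "irw g f k K tie c =
     \<lparr>selection = (\<lambda>h. case irw_state g f k K tie h of (v, ys) \<Rightarrow>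
        if fst v = 0 then v
        else if length ys < K (fst v) then left_child v
        else right_child v),
      stopping = (\<lambda>h. case irw_state g f k K tie h of (v, ys) \<Rightarrow>
        fst v = 0 \<and> sllr (g 0) (f 0) ys > ln (log 2 (2 ^ k) / c)),
      decl = (\<lambda>h. snd (fst (irw_state g f k K tie h)))\<rparr>"

end

theory Submission
  imports Defs
begin

text \<open>
  The sum of the expected number of samples and \<open>1 / c\<close> times the error probability is bounded by the
  initial value of a potential that, along the walk, decreases in conditional expectation by at
  least \<open>1\<close> per sample. Write \<open>\<beta> = \<alpha>\<^sup>2\<close>; the signs of the sum log-likelihood ratios at level \<open>l\<close> are
  correct with probability close to \<open>1\<close> once \<open>K l\<close> is a large multiple of \<open>\<beta> ^ l\<close>. For a node \<open>v\<close> of level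
  \<open>l\<close> whose lowest common ancestor with the target has level \<open>J\<close>, the potential is
  \<open>y * (\<beta> ^ (J + 1) + \<beta> ^ J - \<beta> ^ l)\<close> up to a constant: every move towards the target lowers it by
  \<open>y * \<beta> ^ l * (\<beta> - 1)\<close>, which pays for the \<open>2 * K l\<close> samples of the visit and for the rare wrong moves.
  At the root it is \<open>y * \<beta> ^ (k + 1)\<close>, a multiple of \<open>M powr log 2 (\<alpha>\<^sup>2)\<close>. At a leaf with sum
  log-likelihood ratio \<open>s\<close>, a term linear in \<open>s\<close> with slope \<open>-1 / D\<close> (target) or \<open>1 / D\<close> (other leaf)
  pays for the samples, where \<open>D\<close> is the divergence. The likelihood ratio martingale \<open>exp (- s)\<close> pays for leaving
  the target, and \<open>exp s\<close> for the cost \<open>1 / c\<close> of a wrong declaration.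
\<close>

subsection \<open>Lyapunov bounds for sequential strategies\<close>

text \<open>Consuming the stream from its head, rather than indexing it as \<open>run\<close> does,
  lets the integral over the stream space unfold one probe at a time. The depth \<open>n\<close>
  makes that an induction and is sent to infinity later.\<close>

primrec truncated_cost ::
  "'o strategy \<Rightarrow> nat \<Rightarrow> ennreal \<Rightarrow> nat \<Rightarrow> 'o history \<Rightarrow> (node \<Rightarrow> 'o) stream \<Rightarrow> ennreal" where
  "truncated_cost \<Gamma> m w 0 h \<omega> = 0"
| "truncated_cost \<Gamma> m w (Suc n) h \<omega> =
     (if stopping \<Gamma> h then (if decl \<Gamma> h = m then 0 else w)
      else 1 + truncated_cost \<Gamma> m w n (h @ [(selection \<Gamma> h, shd \<omega> (selection \<Gamma> h))]) (stl \<omega>))"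

lemma truncated_cost_Suc_ge:
  "truncated_cost \<Gamma> m w n h \<omega> \<le> truncated_cost \<Gamma> m w (Suc n) h \<omega>"
proof (induction n arbitrary: h \<omega>)
  case (Suc n)
  show ?case
    unfolding truncated_cost.simps(2)[of \<Gamma> m w "Suc n"]
    by (subst truncated_cost.simps(2)) (simp add: add_left_mono Suc.IH del: truncated_cost.simps)
qed simp

lemma measurable_truncated_cost [measurable]:
  fixes \<Gamma> :: "('o::countable) strategy" and P :: "(node \<Rightarrow> 'o) pmf"
  shows "truncated_cost \<Gamma> m w n h \<in> borel_measurable (stream_space (measure_pmf P))"
proof (induction n arbitrary: h)
  case (Suc n)
  define v where "v = selection \<Gamma> h"
  have obs: "(\<lambda>\<omega>. shd \<omega> v) \<in> measurable (stream_space (measure_pmf P)) (count_space UNIV)"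
    by (rule measurable_compose[OF measurable_shd]) simp
  have "(\<lambda>\<omega>. truncated_cost \<Gamma> m w n (h @ [(v, shd \<omega> v)]) (stl \<omega>))
      \<in> borel_measurable (stream_space (measure_pmf P))"
    by (rule measurable_compose_countable[OF measurable_compose[OF measurable_stl Suc.IH] obs])
  moreover have "truncated_cost \<Gamma> m w (Suc n) h = (if stopping \<Gamma> h then (\<lambda>_. if decl \<Gamma> h = m then 0 else w)
      else (\<lambda>\<omega>. 1 + truncated_cost \<Gamma> m w n (h @ [(v, shd \<omega> v)]) (stl \<omega>)))"
    by (simp add: fun_eq_iff v_def)
  ultimately show ?case by simp
next
  case 0
  have "truncated_cost \<Gamma> m w 0 h = (\<lambda>_. 0)" by (simp add: fun_eq_iff)
  then show ?case by simp
qed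

text \<open>Links the head recursion to \<open>run\<close>. The spare depth \<open>N\<close> lets
  the induction peel off the last probe instead of the first.\<close>

lemma truncated_cost_run:
  assumes "\<And>t. t < n \<Longrightarrow> \<not> stopping \<Gamma> (run \<Gamma> \<omega> t)"
  shows "truncated_cost \<Gamma> m w (n + N) [] \<omega>
       = of_nat n + truncated_cost \<Gamma> m w N (run \<Gamma> \<omega> n) (sdrop n \<omega>)"
  using assms
proof (induction n arbitrary: N)
  case (Suc n)
  have "truncated_cost \<Gamma> m w (Suc n + N) [] \<omega> = truncated_cost \<Gamma> m w (n + Suc N) [] \<omega>"
    by simp
  also have "\<dots> = of_nat n + truncated_cost \<Gamma> m w (Suc N) (run \<Gamma> \<omega> n) (sdrop n \<omega>)"
    using Suc.prems by (intro Suc.IH) auto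
  also have "\<dots> = of_nat (Suc n) + truncated_cost \<Gamma> m w N (run \<Gamma> \<omega> (Suc n)) (sdrop (Suc n) \<omega>)"
    using Suc.prems[of n] by (simp add: Let_def ac_simps sdrop_simps)
  finally show ?case .
qed simp

lemma stop_time_cases:
  obtains (Never) "stop_time \<Gamma> \<omega> = \<infinity>" "\<And>t. \<not> stopping \<Gamma> (run \<Gamma> \<omega> t)"
  | (Stops) n where "stop_time \<Gamma> \<omega> = enat n" "stopping \<Gamma> (run \<Gamma> \<omega> n)"
      "\<And>t. t < n \<Longrightarrow> \<not> stopping \<Gamma> (run \<Gamma> \<omega> t)"
proof (cases "\<exists>t. stopping \<Gamma> (run \<Gamma> \<omega> t)")
  case True
  define n where "n = (LEAST t. stopping \<Gamma> (run \<Gamma> \<omega> t))"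
  have n: "stopping \<Gamma> (run \<Gamma> \<omega> n)" "\<And>t. t < n \<Longrightarrow> \<not> stopping \<Gamma> (run \<Gamma> \<omega> t)"
    using True LeastI_ex[of "\<lambda>t. stopping \<Gamma> (run \<Gamma> \<omega> t)"] not_less_Least unfolding n_def by blast+
  have "stop_time \<Gamma> \<omega> = enat n"
    unfolding stop_time_def
    by (intro antisym INF_lower INF_greatest) (use n in \<open>auto simp: not_less[symmetric]\<close>)
  with n show ?thesis using Stops by blast
next
  case False
  then show ?thesis using Never by (simp add: stop_time_def top_enat_def)
qed

lemma cost_le_SUP_truncated_cost:
  "ennreal_of_enat (stop_time \<Gamma> \<omega>) + w * indicator {\<omega>. \<not> declares \<Gamma> \<omega> m} \<omega>
   \<le> (SUP n. truncated_cost \<Gamma> m w n [] \<omega>)"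
proof (cases \<Gamma> \<omega> rule: stop_time_cases)
  case Never
  have "truncated_cost \<Gamma> m w n [] \<omega> = of_nat n" for n
    using truncated_cost_run[of n \<Gamma> \<omega> m w 0] Never by simp
  then show ?thesis by (simp add: ennreal_SUP_of_nat_eq_top)
next
  case (Stops n)
  \<comment> \<open>Depth \<open>n + 1\<close>: \<open>n\<close> probes and one further unfolding
    that charges the declaration.\<close>
  have "truncated_cost \<Gamma> m w (n + 1) [] \<omega> = of_nat n + (if decl \<Gamma> (run \<Gamma> \<omega> n) = m then 0 else w)"
    using truncated_cost_run[of n \<Gamma> \<omega> m w 1] Stops by simp
  also have "\<dots> = ennreal_of_enat (stop_time \<Gamma> \<omega>) + w * indicator {\<omega>. \<not> declares \<Gamma> \<omega> m} \<omega>"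
    using Stops by (simp add: declares_def)
  finally show ?thesis by (metis SUP_upper UNIV_I)
qed

lemma finite_tree_nodes [simp]: "finite (tree_nodes k)"
proof (rule finite_subset)
  show "tree_nodes k \<subseteq> {..k} \<times> {..2 ^ k}"
    unfolding tree_nodes_def
    by (auto intro: order_trans[OF less_imp_le] power_increasing)
qed auto

lemma nn_integral_observation:
  assumes "v \<in> tree_nodes k"
  shows "(\<integral>\<^sup>+x. F (x v) \<partial>Pi_pmf (tree_nodes k) undefined (obs_pmf g f m))
       = (\<integral>\<^sup>+y. F y \<partial>obs_pmf g f m v)"
proof -
  have "(\<integral>\<^sup>+y. F y \<partial>obs_pmf g f m v)
      = (\<integral>\<^sup>+y. F y \<partial>map_pmf (\<lambda>x. x v) (Pi_pmf (tree_nodes k) undefined (obs_pmf g f m)))"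
    using assms by (simp add: Pi_pmf_component)
  then show ?thesis by simp
qed

text \<open>Supermartingale argument: integrate out the first probe, of which only the marginal at
  the selected node matters, and apply the drift condition. \<open>valid\<close> confines that
  condition to an invariant set of histories.\<close>

lemma nn_integral_truncated_cost_le:
  fixes \<Gamma> :: "('o::countable) strategy" and \<Phi> :: "'o history \<Rightarrow> ennreal"
  assumes sel: "\<And>h. valid h \<Longrightarrow> \<not> stopping \<Gamma> h \<Longrightarrow> selection \<Gamma> h \<in> tree_nodes k"
    and step: "\<And>h y. valid h \<Longrightarrow> \<not> stopping \<Gamma> h \<Longrightarrow> valid (h @ [(selection \<Gamma> h, y)])"
    and stop: "\<And>h. valid h \<Longrightarrow> stopping \<Gamma> h \<Longrightarrow> decl \<Gamma> h \<noteq> m \<Longrightarrow> w \<le> \<Phi> h"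
    and drift: "\<And>h. valid h \<Longrightarrow> \<not> stopping \<Gamma> h \<Longrightarrow>
      1 + (\<integral>\<^sup>+y. \<Phi> (h @ [(selection \<Gamma> h, y)]) \<partial>obs_pmf g f m (selection \<Gamma> h)) \<le> \<Phi> h"
    and "valid h"
  shows "(\<integral>\<^sup>+\<omega>. truncated_cost \<Gamma> m w n h \<omega> \<partial>hyp_space g f k m) \<le> \<Phi> h"
  using \<open>valid h\<close>
proof (induction n arbitrary: h)
  case (Suc n)
  define P where "P = Pi_pmf (tree_nodes k) undefined (obs_pmf g f m)"
  interpret S: prob_space "stream_space (measure_pmf P)"
    by (rule prob_space.prob_space_stream_space) (rule prob_space_measure_pmf)
  have IH: "(\<integral>\<^sup>+\<omega>. truncated_cost \<Gamma> m w n h' \<omega> \<partial>stream_space (measure_pmf P)) \<le> \<Phi> h'" if "valid h'" for h'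
    using Suc.IH[OF that] by (simp add: hyp_space_def P_def)
  show ?case
  proof (cases "stopping \<Gamma> h")
    case True
    then show ?thesis
      using stop[OF Suc.prems] S.emeasure_space_1
      by (auto simp: hyp_space_def P_def)
  next
    case False
    define v where "v = selection \<Gamma> h"
    have "(\<integral>\<^sup>+\<omega>. truncated_cost \<Gamma> m w (Suc n) h \<omega> \<partial>hyp_space g f k m)
        = (\<integral>\<^sup>+x. \<integral>\<^sup>+\<omega>. truncated_cost \<Gamma> m w (Suc n) h (x ## \<omega>) \<partial>stream_space (measure_pmf P) \<partial>P)"
      unfolding hyp_space_def P_def[symmetric]
      by (intro prob_space.nn_integral_stream_space prob_space_measure_pmf measurable_truncated_cost)
    also have "\<dots> = (\<integral>\<^sup>+x. 1 + (\<integral>\<^sup>+\<omega>. truncated_cost \<Gamma> m w n (h @ [(v, x v)]) \<omega> \<partial>stream_space (measure_pmf P)) \<partial>P)"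
      using False S.emeasure_space_1
      by (simp add: v_def nn_integral_add)
    also have "\<dots> \<le> (\<integral>\<^sup>+x. 1 + \<Phi> (h @ [(v, x v)]) \<partial>P)"
      using step[OF Suc.prems False] by (intro nn_integral_mono add_left_mono IH) (simp add: v_def)
    also have "\<dots> = 1 + (\<integral>\<^sup>+x. \<Phi> (h @ [(v, x v)]) \<partial>P)"
      by (simp add: nn_integral_add)
    also have "\<dots> = 1 + (\<integral>\<^sup>+y. \<Phi> (h @ [(v, y)]) \<partial>obs_pmf g f m v)"
      using sel[OF Suc.prems False]
      unfolding P_def by (subst nn_integral_observation) (auto simp: v_def)
    also have "\<dots> \<le> \<Phi> h" using drift[OF Suc.prems False] by (simp add: v_def)
    finally show ?thesis .
  qed
next
  case 0
  have "truncated_cost \<Gamma> m w 0 h = (\<lambda>_. 0)" for h by (simp add: fun_eq_iff)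
  then show ?case by simp
qed

section \<open>Measurability of runs, stopping times and declarations\<close>

lemma measurable_run:
  fixes \<Gamma> :: "('o::countable) strategy" and P :: "(node \<Rightarrow> 'o) pmf"
  shows "(\<lambda>\<omega>. run \<Gamma> \<omega> t) \<in> measurable (stream_space (measure_pmf P)) (count_space UNIV)"
proof (induction t)
  case (Suc t)
  have "(\<lambda>\<omega>. h @ [(v, (\<omega> !! t) v)]) \<in> measurable (stream_space (measure_pmf P)) (count_space UNIV)" for h v
    by (rule measurable_compose[OF measurable_snth]) simp
  then have "(\<lambda>\<omega>. (\<lambda>h \<omega>. h @ [(selection \<Gamma> h, (\<omega> !! t) (selection \<Gamma> h))]) (run \<Gamma> \<omega> t) \<omega>)
      \<in> measurable (stream_space (measure_pmf P)) (count_space UNIV)"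
    by (rule measurable_compose_countable[OF _ Suc.IH])
  then show ?case by (simp add: Let_def)
qed simp

lemma measurable_stop_time:
  fixes \<Gamma> :: "('o::countable) strategy"
  shows "(\<lambda>\<omega>. stop_time \<Gamma> \<omega>) \<in> measurable (hyp_space g f k m) (count_space UNIV)"
proof -
  note [measurable] = measurable_run
  have *: "stop_time \<Gamma> \<omega> = (if \<exists>t. stopping \<Gamma> (run \<Gamma> \<omega> t)
      then enat (LEAST t. stopping \<Gamma> (run \<Gamma> \<omega> t)) else \<infinity>)" for \<omega>
    by (cases \<Gamma> \<omega> rule: stop_time_cases)
      (auto intro!: Least_equality[symmetric] simp: not_less[symmetric])
  show ?thesis unfolding * hyp_space_def by measurable
qed

lemma sets_declares:
  fixes \<Gamma> :: "('o::countable) strategy"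
  shows "{\<omega> \<in> space (hyp_space g f k m). \<not> declares \<Gamma> \<omega> m'} \<in> sets (hyp_space g f k m)"
proof -
  note [measurable] = measurable_run measurable_stop_time
  have [measurable]: "(\<lambda>\<omega>. run \<Gamma> \<omega> t) \<in> measurable (hyp_space g f k m) (count_space UNIV)" for t
    unfolding hyp_space_def by measurable
  show ?thesis unfolding declares_def by measurable
qed

text \<open>Monotone convergence in the truncation depth. Runs that never stop are charged infinite
  time, so a finite \<open>\<Phi> []\<close> also forces them to be null.\<close>

lemma lyapunov_risk_bound:
  fixes \<Gamma> :: "('o::countable) strategy" and \<Phi> :: "'o history \<Rightarrow> ennreal"
  assumes "\<And>h. valid h \<Longrightarrow> \<not> stopping \<Gamma> h \<Longrightarrow> selection \<Gamma> h \<in> tree_nodes k"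
    and "\<And>h y. valid h \<Longrightarrow> \<not> stopping \<Gamma> h \<Longrightarrow> valid (h @ [(selection \<Gamma> h, y)])"
    and "\<And>h. valid h \<Longrightarrow> stopping \<Gamma> h \<Longrightarrow> decl \<Gamma> h \<noteq> m \<Longrightarrow> w \<le> \<Phi> h"
    and "\<And>h. valid h \<Longrightarrow> \<not> stopping \<Gamma> h \<Longrightarrow>
      1 + (\<integral>\<^sup>+y. \<Phi> (h @ [(selection \<Gamma> h, y)]) \<partial>obs_pmf g f m (selection \<Gamma> h)) \<le> \<Phi> h"
    and "valid []"
  shows "w * emeasure (hyp_space g f k m) {\<omega> \<in> space (hyp_space g f k m). \<not> declares \<Gamma> \<omega> m}
       + (\<integral>\<^sup>+\<omega>. ennreal_of_enat (stop_time \<Gamma> \<omega>) \<partial>hyp_space g f k m) \<le> \<Phi> []"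
proof -
  let ?H = "hyp_space g f k m"
  have [measurable]: "(\<lambda>\<omega>. ennreal_of_enat (stop_time \<Gamma> \<omega>)) \<in> borel_measurable ?H"
    by (rule measurable_compose[OF measurable_stop_time]) simp
  have [measurable]: "{\<omega> \<in> space ?H. \<not> declares \<Gamma> \<omega> m} \<in> sets ?H"
    by (rule sets_declares)
  have [measurable]: "truncated_cost \<Gamma> m w n [] \<in> borel_measurable ?H" for n
    unfolding hyp_space_def by measurable
  have "w * emeasure ?H {\<omega> \<in> space ?H. \<not> declares \<Gamma> \<omega> m}
       + (\<integral>\<^sup>+\<omega>. ennreal_of_enat (stop_time \<Gamma> \<omega>) \<partial>?H)
     = (\<integral>\<^sup>+\<omega>. w * indicator {\<omega> \<in> space ?H. \<not> declares \<Gamma> \<omega> m} \<omega> + ennreal_of_enat (stop_time \<Gamma> \<omega>) \<partial>?H)"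
    by (simp add: nn_integral_add nn_integral_cmult)
  also have "\<dots> \<le> (\<integral>\<^sup>+\<omega>. (SUP n. truncated_cost \<Gamma> m w n [] \<omega>) \<partial>?H)"
    using cost_le_SUP_truncated_cost[of \<Gamma> _ w m]
    by (intro nn_integral_mono) (simp add: indicator_def add.commute)
  also have "\<dots> = (SUP n. \<integral>\<^sup>+\<omega>. truncated_cost \<Gamma> m w n [] \<omega> \<partial>?H)"
    by (rule nn_integral_monotone_convergence_SUP)
      (auto intro!: incseq_SucI le_funI truncated_cost_Suc_ge simp del: truncated_cost.simps)
  also have "\<dots> \<le> \<Phi> []"
    by (intro SUP_least nn_integral_truncated_cost_le[where valid = valid]) (use assms in auto)
  finally show ?thesis .
qed

subsection \<open>Sum log-likelihood ratios of Bernoulli samples\<close>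

definition bern_llr :: "real \<Rightarrow> real" where
  "bern_llr u = ln ((1 - u) / u)"

lemma bern_llr_pos: "0 < u \<Longrightarrow> u < 1 / 2 \<Longrightarrow> 0 < bern_llr u"
  by (simp add: bern_llr_def field_simps)

lemma exp_bern_llr: "0 < u \<Longrightarrow> u < 1 \<Longrightarrow> exp (bern_llr u) = (1 - u) / u"
  by (simp add: bern_llr_def)

lemma ln_bernoulli_ratio:
  assumes "0 < u" "u < 1"
  shows "ln (pmf (bernoulli_pmf (1 - u)) b / pmf (bernoulli_pmf u) b) = (if b then bern_llr u else - bern_llr u)"
  using assms by (cases b) (simp_all add: bern_llr_def ln_div)

lemma sllr_Nil [simp]: "sllr q r [] = 0"
  by (simp add: sllr_def)

lemma sllr_append: "sllr q r (xs @ ys) = sllr q r xs + sllr q r ys"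
  by (simp add: sllr_def)

lemma sllr_bernoulli_Cons:
  assumes "0 < u" "u < 1"
  shows "sllr (bernoulli_pmf (1 - u)) (bernoulli_pmf u) (b # xs)
       = (if b then bern_llr u else - bern_llr u) + sllr (bernoulli_pmf (1 - u)) (bernoulli_pmf u) xs"
  using ln_bernoulli_ratio[OF assms] by (simp add: sllr_def)

lemma sllr_bernoulli_snoc:
  assumes "0 < u" "u < 1"
  shows "sllr (bernoulli_pmf (1 - u)) (bernoulli_pmf u) (xs @ [b])
       = sllr (bernoulli_pmf (1 - u)) (bernoulli_pmf u) xs + (if b then bern_llr u else - bern_llr u)"
  using sllr_bernoulli_Cons[OF assms, of b "[]"] by (simp add: sllr_append)

lemma sllr_bernoulli_lattice:
  assumes "0 < u" "u < 1"
  shows "\<exists>j::int. sllr (bernoulli_pmf (1 - u)) (bernoulli_pmf u) xs = of_int j * bern_llr u"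
proof (induction xs)
  case Nil
  then show ?case by (auto intro: exI[of _ 0])
next
  case (Cons b xs)
  then obtain j where "sllr (bernoulli_pmf (1 - u)) (bernoulli_pmf u) xs = of_int j * bern_llr u"
    by blast
  then show ?case
    by (intro exI[of _ "if b then j + 1 else j - 1"])
      (simp add: sllr_bernoulli_Cons[OF assms] algebra_simps)
qed

text \<open>The sums live on a lattice of mesh \<open>bern_llr u\<close>, so a negative one is at
  least a full step below 0. This gap gives \<open>exp (- s)\<close> a fixed growth factor whenever
  the walk leaves the target leaf.\<close>

lemma sllr_bernoulli_neg_imp_le:
  assumes "0 < u" "u < 1 / 2" "sllr (bernoulli_pmf (1 - u)) (bernoulli_pmf u) xs < 0"
  shows "sllr (bernoulli_pmf (1 - u)) (bernoulli_pmf u) xs \<le> - bern_llr u"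
proof -
  obtain j where j: "sllr (bernoulli_pmf (1 - u)) (bernoulli_pmf u) xs = of_int j * bern_llr u"
    using sllr_bernoulli_lattice[of u xs] assms by auto
  have "j \<le> - 1"
    using assms(3) bern_llr_pos[OF assms(1,2)] unfolding j by (simp add: mult_less_0_iff)
  then have "of_int j \<le> (- 1 :: real)" by linarith
  then have "of_int j * bern_llr u \<le> - 1 * bern_llr u"
    using bern_llr_pos[OF assms(1,2)] by (intro mult_right_mono) auto
  then show ?thesis unfolding j by simp
qed

text \<open>The Bhattacharyya coefficient of the Bernoulli distributions with parameters \<open>u\<close> and \<open>1 - u\<close>.\<close>

definition bhatt :: "real \<Rightarrow> real" where
  "bhatt u = 2 * sqrt (u * (1 - u))"

lemma bhatt_nonneg: "0 \<le> u \<Longrightarrow> u \<le> 1 \<Longrightarrow> 0 \<le> bhatt u"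
  by (simp add: bhatt_def)

text \<open>The half-step exponential is \<open>sqrt (1 - u) / sqrt u\<close>, so both summands
  equal \<open>sqrt (u * (1 - u))\<close>.\<close>

lemma bhatt_eq:
  assumes "0 < u" "u < 1"
  shows "u * exp (bern_llr u / 2) + (1 - u) * exp (- bern_llr u / 2) = bhatt u"
proof -
  define a b where "a = sqrt u" and "b = sqrt (1 - u)"
  have ab: "0 < a" "0 < b" "u = a * a" "1 - u = b * b" "bhatt u = 2 * (a * b)"
    using assms by (simp_all add: a_def b_def bhatt_def real_sqrt_mult)
  have "(exp (bern_llr u / 2))\<^sup>2 = exp (bern_llr u)"
    by (simp add: power2_eq_square mult_exp_exp)
  then have "(exp (bern_llr u / 2))\<^sup>2 = (b / a)\<^sup>2"
    unfolding exp_bern_llr[OF assms] ab(4) by (simp add: ab(3) power2_eq_square)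
  then have e: "exp (bern_llr u / 2) = b / a"
    by (rule power2_eq_imp_eq) (use ab in auto)
  have e': "exp (- bern_llr u / 2) = a / b"
    using e by (simp add: exp_minus)
  show ?thesis unfolding e e' ab(4,5) using ab(1,2) by (simp add: ab(3))
qed

text \<open>The sign \<open>s = 1\<close> belongs to samples from \<open>f\<close> and
  \<open>s = - 1\<close> to samples from \<open>g\<close>. By symmetry both give the same moment, so
  one tail bound serves both.\<close>

lemma bhatt_tilt:
  assumes "0 < u" "u < 1" and "s = 1 \<and> v = u \<or> s = - 1 \<and> v = 1 - u"
  shows "v * exp (s * bern_llr u / 2) + (1 - v) * exp (- s * bern_llr u / 2) = bhatt u"
  using assms(3) bhatt_eq[OF assms(1,2)] by auto

text \<open>The square is \<open>1 - 4 * (1 / 2 - u)\<^sup>2\<close>; then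
  \<open>1 + x \<le> exp x\<close>.\<close>

lemma bhatt_le_exp:
  assumes "0 < u" "u < 1"
  shows "bhatt u \<le> exp (- 2 * (1 / 2 - u)\<^sup>2)"
proof -
  have "(bhatt u)\<^sup>2 = 1 + (- 4 * (1 / 2 - u)\<^sup>2)"
    using assms by (simp add: bhatt_def power_mult_distrib) (simp add: power2_eq_square field_simps)
  also have "\<dots> \<le> exp (- 4 * (1 / 2 - u)\<^sup>2)" by (rule exp_ge_add_one_self)
  also have "\<dots> = (exp (- 2 * (1 / 2 - u)\<^sup>2))\<^sup>2" by (simp flip: exp_double)
  finally show ?thesis by (rule power2_le_imp_le) simp
qed

section \<open>Chernoff bounds for the signs, and the confidence levels\<close>

lemma nn_integral_bernoulli_ennreal:
  assumes "0 \<le> v" "v \<le> 1" "\<And>b. 0 \<le> \<phi> b"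
  shows "(\<integral>\<^sup>+b. ennreal (\<phi> b) \<partial>bernoulli_pmf v) = ennreal (v * \<phi> True + (1 - v) * \<phi> False)"
  using assms by (simp add: ennreal_plus ennreal_mult ac_simps)

text \<open>Exponential moment at exponent 1/2: by independence each sample contributes one
  Bhattacharyya factor.\<close>

lemma nn_integral_exp_sllr:
  assumes u: "0 < u" "u < 1" and s: "s = 1 \<and> v = u \<or> s = - 1 \<and> v = 1 - u"
  shows "(\<integral>\<^sup>+xs. ennreal (exp (s * sllr (bernoulli_pmf (1 - u)) (bernoulli_pmf u) xs / 2))
           \<partial>replicate_pmf n (bernoulli_pmf v)) = ennreal (bhatt u ^ n)"
proof (induction n)
  case (Suc n)
  let ?L = "sllr (bernoulli_pmf (1 - u)) (bernoulli_pmf u)"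
  have v: "0 \<le> v" "v \<le> 1" using u s by auto
  have Cons: "(\<integral>\<^sup>+xs. ennreal (exp (s * ?L (b # xs) / 2)) \<partial>replicate_pmf n (bernoulli_pmf v))
      = ennreal (exp ((if b then s else - s) * bern_llr u / 2) * bhatt u ^ n)" for b
  proof -
    have "exp (s * ?L (b # xs) / 2)
        = exp ((if b then s else - s) * bern_llr u / 2) * exp (s * ?L xs / 2)" for xs
      unfolding sllr_bernoulli_Cons[OF u] mult_exp_exp by (rule arg_cong[of _ _ exp]) (simp add: field_simps)
    then show ?thesis using Suc.IH by (simp add: ennreal_mult' nn_integral_cmult)
  qed
  have "(\<integral>\<^sup>+xs. ennreal (exp (s * ?L xs / 2)) \<partial>replicate_pmf (Suc n) (bernoulli_pmf v))
      = (\<integral>\<^sup>+b. \<integral>\<^sup>+xs. ennreal (exp (s * ?L (b # xs) / 2)) \<partial>replicate_pmf n (bernoulli_pmf v)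
           \<partial>bernoulli_pmf v)"
    by (simp add: nn_integral_bind_pmf del: nn_integral_bernoulli_pmf)
  also have "\<dots> = ennreal (v * (exp (s * bern_llr u / 2) * bhatt u ^ n)
      + (1 - v) * (exp (- s * bern_llr u / 2) * bhatt u ^ n))"
    unfolding Cons using u v bhatt_nonneg[of u] by (subst nn_integral_bernoulli_ennreal) auto
  also have "\<dots> = ennreal ((v * exp (s * bern_llr u / 2) + (1 - v) * exp (- s * bern_llr u / 2)) * bhatt u ^ n)"
    by (simp add: algebra_simps)
  finally show ?case unfolding bhatt_tilt[OF assms] by simp
qed simp

text \<open>Markov's inequality at threshold 1.\<close>

lemma prob_le_of_nn_integral:
  assumes "(\<integral>\<^sup>+x. ennreal (\<phi> x) \<partial>measure_pmf P) = ennreal r" "0 \<le> r" "\<And>x. x \<in> A \<Longrightarrow> 1 \<le> \<phi> x"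
  shows "measure_pmf.prob P A \<le> r"
proof -
  have "emeasure P A = (\<integral>\<^sup>+x. indicator A x \<partial>measure_pmf P)" by simp
  also have "\<dots> \<le> (\<integral>\<^sup>+x. ennreal (\<phi> x) \<partial>measure_pmf P)"
    using assms(3) by (intro nn_integral_mono) (auto simp: indicator_def)
  finally show ?thesis
    using assms(1,2) by (simp add: measure_pmf.emeasure_eq_measure)
qed

lemma prob_sllr_null_ge:
  assumes "0 < u" "u < 1"
  shows "measure_pmf.prob (replicate_pmf n (bernoulli_pmf u))
    {xs. 0 \<le> sllr (bernoulli_pmf (1 - u)) (bernoulli_pmf u) xs} \<le> bhatt u ^ n"
  by (rule prob_le_of_nn_integral[OF nn_integral_exp_sllr[of u 1 u n]])
    (use assms bhatt_nonneg[of u] in auto)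

lemma prob_sllr_alt_le:
  assumes "0 < u" "u < 1"
  shows "measure_pmf.prob (replicate_pmf n (bernoulli_pmf (1 - u)))
    {xs. sllr (bernoulli_pmf (1 - u)) (bernoulli_pmf u) xs \<le> 0} \<le> bhatt u ^ n"
  by (rule prob_le_of_nn_integral[OF nn_integral_exp_sllr[of u "- 1" "1 - u" n]])
    (use assms bhatt_nonneg[of u] in auto)

text \<open>With \<open>q\<close> the one-child error probability,
  \<open>(1 - q)\<^sup>2 \<ge> 1 - 2 * q\<close>.\<close>

lemma conf_f_ge:
  assumes "0 < u" "u < 1"
  shows "1 - 2 * bhatt u ^ n \<le> conf_f (bernoulli_pmf (1 - u)) (bernoulli_pmf u) n"
proof -
  define q where "q = measure_pmf.prob (replicate_pmf n (bernoulli_pmf u))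
    {xs. 0 \<le> sllr (bernoulli_pmf (1 - u)) (bernoulli_pmf u) xs}"
  have q: "q \<le> bhatt u ^ n" unfolding q_def by (rule prob_sllr_null_ge[OF assms])
  have "{xs. sllr (bernoulli_pmf (1 - u)) (bernoulli_pmf u) xs < 0}
      = UNIV - {xs. 0 \<le> sllr (bernoulli_pmf (1 - u)) (bernoulli_pmf u) xs}" by auto
  then have "conf_f (bernoulli_pmf (1 - u)) (bernoulli_pmf u) n = (1 - q)\<^sup>2"
    using measure_pmf.prob_compl[of "{xs. 0 \<le> sllr (bernoulli_pmf (1 - u)) (bernoulli_pmf u) xs}"
        "replicate_pmf n (bernoulli_pmf u)"]
    by (simp add: conf_f_def q_def)
  also have "\<dots> = 1 - 2 * q + q\<^sup>2" by (simp add: power2_eq_square algebra_simps)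
  finally show ?thesis using q zero_le_power2[of q] by linarith
qed

text \<open>Union bound: a positive sum on the target side and a negative one on the other side
  already imply the event.\<close>

lemma conf_g_ge:
  assumes "0 < u" "u < 1"
  shows "1 - 2 * bhatt u ^ n \<le> conf_g (bernoulli_pmf (1 - u)) (bernoulli_pmf u) n"
proof -
  let ?L = "sllr (bernoulli_pmf (1 - u)) (bernoulli_pmf u)"
  define G where "G = replicate_pmf n (bernoulli_pmf (1 - u))"
  define F where "F = replicate_pmf n (bernoulli_pmf u)"
  let ?P = "pair_pmf G F"
  have "1 - conf_g (bernoulli_pmf (1 - u)) (bernoulli_pmf u) n
      = measure_pmf.prob ?P (UNIV - {(ys, zs). ?L ys > max (?L zs) 0})"
    using measure_pmf.prob_compl[of "{(ys, zs). ?L ys > max (?L zs) 0}" ?P]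
    by (simp add: conf_g_def G_def F_def)
  also have "\<dots> \<le> measure_pmf.prob ?P (fst -` {ys. ?L ys \<le> 0} \<union> snd -` {zs. 0 \<le> ?L zs})"
    by (rule measure_pmf.finite_measure_mono) auto
  also have "\<dots> \<le> measure_pmf.prob ?P (fst -` {ys. ?L ys \<le> 0}) + measure_pmf.prob ?P (snd -` {zs. 0 \<le> ?L zs})"
    by (rule measure_subadditive) auto
  also have "\<dots> = measure_pmf.prob G {ys. ?L ys \<le> 0} + measure_pmf.prob F {zs. 0 \<le> ?L zs}"
    by (simp only: measure_map_pmf[symmetric] map_fst_pair_pmf map_snd_pair_pmf)
  also have "\<dots> \<le> bhatt u ^ n + bhatt u ^ n"
    unfolding G_def F_def by (intro add_mono prob_sllr_null_ge prob_sllr_alt_le assms)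
  finally show ?thesis by simp
qed

text \<open>The reference measure is the first argument, so this is D(g||f) in natural units: the
  mean under \<open>g\<close> of an increment that is plus or minus
  \<open>bern_llr u\<close>.\<close>

lemma KL_bernoulli:
  assumes "0 < u" "u < 1"
  shows "KL_divergence (exp 1) (measure_pmf (bernoulli_pmf u)) (measure_pmf (bernoulli_pmf (1 - u)))
       = (1 - 2 * u) * bern_llr u"
proof -
  interpret sigma_finite_measure "count_space (UNIV :: bool set)"
    by (rule sigma_finite_measure_count_space)
  have "KL_divergence (exp 1) (measure_pmf (bernoulli_pmf u)) (measure_pmf (bernoulli_pmf (1 - u)))
     = (\<integral>b. pmf (bernoulli_pmf (1 - u)) b * log (exp 1) (pmf (bernoulli_pmf (1 - u)) b / pmf (bernoulli_pmf u) b)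
          \<partial>count_space UNIV)"
    unfolding measure_pmf_eq_density
  proof (rule KL_density_density)
    show "AE b in count_space UNIV. pmf (bernoulli_pmf u) b = 0 \<longrightarrow> pmf (bernoulli_pmf (1 - u)) b = 0"
      using assms by (auto simp: AE_count_space pmf_eq_0_set_pmf)
  qed auto
  also have "\<dots> = (\<Sum>b\<in>UNIV. pmf (bernoulli_pmf (1 - u)) b * (if b then bern_llr u else - bern_llr u))"
    using ln_bernoulli_ratio[OF assms] by (simp add: lebesgue_integral_count_space_finite log_def)
  also have "\<dots> = (1 - 2 * u) * bern_llr u"
    using assms by (simp add: UNIV_bool algebra_simps)
  finally show ?thesis .
qed

subsection \<open>The potential of the random walk\<close>

lemma in_subtree_children:
  assumes "fst v > 0"
  shows "in_subtree m v \<Longrightarrow> in_subtree m (left_child v) \<noteq> in_subtree m (right_child v)"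
    and "\<not> in_subtree m v \<Longrightarrow> \<not> in_subtree m (left_child v)"
    and "\<not> in_subtree m v \<Longrightarrow> \<not> in_subtree m (right_child v)"
proof -
  obtain j where "fst v = Suc j" using assms by (cases "fst v") auto
  then have *: "in_subtree m v \<longleftrightarrow> m div 2 ^ j div 2 = snd v"
    "in_subtree m (left_child v) \<longleftrightarrow> m div 2 ^ j = 2 * snd v"
    "in_subtree m (right_child v) \<longleftrightarrow> m div 2 ^ j = 2 * snd v + 1"
    by (simp_all add: in_subtree_def left_child_def right_child_def div_mult2_eq mult.commute[of 2 "2 ^ j"])
  show "in_subtree m v \<Longrightarrow> in_subtree m (left_child v) \<noteq> in_subtree m (right_child v)"
    "\<not> in_subtree m v \<Longrightarrow> \<not> in_subtree m (left_child v)"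
    "\<not> in_subtree m v \<Longrightarrow> \<not> in_subtree m (right_child v)"
    unfolding * by auto
qed

lemma parent_child:
  assumes "v \<in> tree_nodes k" "fst v > 0"
  shows "parent k (left_child v) = v" "parent k (right_child v) = v"
  using assms by (auto simp: parent_def left_child_def right_child_def tree_nodes_def root_node_def)

lemma child_in_tree:
  assumes "v \<in> tree_nodes k" "fst v > 0"
  shows "left_child v \<in> tree_nodes k" "right_child v \<in> tree_nodes k"
proof -
  obtain l i where v: "v = (Suc l, i)" using assms(2) by (cases v; cases "fst v") auto
  have "k - l = Suc (k - Suc l)" using assms(1) v by (auto simp: tree_nodes_def)
  then have "(2::nat) ^ (k - l) = 2 * 2 ^ (k - Suc l)" by simp
  then show "left_child v \<in> tree_nodes k" "right_child v \<in> tree_nodes k"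
    using assms(1) by (auto simp: v tree_nodes_def left_child_def right_child_def)
qed

lemma parent_in_tree:
  assumes "v \<in> tree_nodes k"
  shows "parent k v \<in> tree_nodes k"
proof (cases "v = root_node k")
  case False
  obtain l i where v: "v = (l, i)" by (cases v)
  have "l < k" using False assms by (auto simp: v tree_nodes_def root_node_def le_less)
  then have "k - l = Suc (k - Suc l)" by simp
  then have "(2::nat) ^ (k - l) = 2 * 2 ^ (k - Suc l)" by simp
  then show ?thesis
    using assms False \<open>l < k\<close> by (auto simp: v tree_nodes_def parent_def)
qed (use assms in \<open>simp add: parent_def\<close>)

lemma fst_child [simp]: "fst (left_child v) = fst v - 1" "fst (right_child v) = fst v - 1"
  by (simp_all add: left_child_def right_child_def)

text \<open>The two quotients are the indices of the ancestors, at level \<open>fst v + d\<close>,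
  of leaf \<open>m\<close> and of \<open>v\<close>.\<close>

definition lca_level :: "nat \<Rightarrow> node \<Rightarrow> nat" where
  "lca_level m v = fst v + (LEAST d. m div 2 ^ (fst v + d) = snd v div 2 ^ d)"

lemma lca_level_in_subtree: "in_subtree m v \<Longrightarrow> lca_level m v = fst v"
  by (simp add: lca_level_def in_subtree_def Least_eq_0)

lemma fst_le_lca_level: "fst v \<le> lca_level m v"
  by (simp add: lca_level_def)

lemma root_in_subtree: "m < 2 ^ k \<Longrightarrow> in_subtree m (root_node k)"
  by (simp add: in_subtree_def root_node_def)

lemma lca_level_parent:
  assumes "v \<in> tree_nodes k" "m < 2 ^ k" "\<not> in_subtree m v"
  shows "lca_level m (parent k v) = lca_level m v"
proof -
  let ?P = "\<lambda>d. m div 2 ^ (fst v + d) = snd v div 2 ^ d"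
  \<comment> \<open>At level \<open>k\<close> both ancestors are the root, so a common ancestor
    exists.\<close>
  have "?P (k - fst v)" using assms(1,2) by (auto simp: tree_nodes_def)
  moreover have "\<not> ?P 0" using assms(3) by (simp add: in_subtree_def)
  ultimately have "(LEAST d. ?P d) = Suc (LEAST d. ?P (Suc d))" by (rule Least_Suc)
  moreover have "v \<noteq> root_node k" using assms(2,3) root_in_subtree by blast
  ultimately show ?thesis by (simp add: lca_level_def parent_def div_mult2_eq)
qed

section \<open>Transitions of the walk and the definition of the potential\<close>

lemma irw_state_Nil [simp]: "irw_state g f k K tie [] = (root_node k, [])"
  by (simp add: irw_state_def)

lemma irw_state_snoc [simp]:
  "irw_state g f k K tie (h @ [(w, b)]) = irw_step g f k K tie (irw_state g f k K tie h) b"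
  by (simp add: irw_state_def)

lemma irw_move_cases:
  "irw_move g f k K tie v ys \<in> {parent k v, left_child v, right_child v}"
  by (simp add: irw_move_def Let_def)

lemma irw_move_in_tree:
  assumes "v \<in> tree_nodes k" "fst v > 0"
  shows "irw_move g f k K tie v ys \<in> tree_nodes k"
  using irw_move_cases[of g f k K tie v ys] child_in_tree[OF assms] parent_in_tree[OF assms(1)] by auto

text \<open>The last three assumptions are the budget of the potential. Call
  \<open>y * \<beta> ^ l * (\<beta> - 1)\<close> the toll of level \<open>l\<close>. The toll covers
  the samples of an internal visit and its penalty for errors (\<open>internal_bound\<close>), and
  the start value of a visit to a wrong leaf (\<open>wrong_leaf_bound\<close>). The growth of
  \<open>z * exp (- s)\<close> covers a departure from the target
  (\<open>target_leaf_bound\<close>).\<close>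

locale irw_bernoulli =
  fixes \<mu> :: "nat \<Rightarrow> real" and K :: "nat \<Rightarrow> nat" and \<beta> y z c :: real and k m :: nat
    and tie :: "node \<Rightarrow> bool"
  assumes mu_pos: "\<And>l. 0 < \<mu> l" and mu_less: "\<And>l. \<mu> l < 1 / 2"
    and beta: "1 < \<beta>" and y_nonneg: "0 \<le> y" and z_nonneg: "0 \<le> z"
    and k_pos: "1 \<le> k" and c_pos: "0 < c" and c_less: "c < 1" and m_less: "m < 2 ^ k"
    and K_pos: "\<And>l. 1 \<le> l \<Longrightarrow> 0 < K l"
    and internal_bound: "\<And>l. 1 \<le> l \<Longrightarrow>
      2 * real (K l) + 2 * (y * \<beta> ^ l * (\<beta>\<^sup>2 + 1)) * bhatt (\<mu> (l - 1)) ^ K l \<le> y * \<beta> ^ l * (\<beta> - 1)"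
    and wrong_leaf_bound: "1 / (1 - 2 * \<mu> 0) + 1 \<le> y * (\<beta> - 1)"
    and target_leaf_bound: "y * \<beta>\<^sup>2 \<le> z * (exp (bern_llr (\<mu> 0)) - 1)"
begin

abbreviation "f l \<equiv> bernoulli_pmf (\<mu> l)"
abbreviation "g l \<equiv> bernoulli_pmf (1 - \<mu> l)"
abbreviation "leaf_sllr \<equiv> sllr (g 0) (f 0)"

definition lam :: real where "lam = bern_llr (\<mu> 0)"
definition D :: real where "D = (1 - 2 * \<mu> 0) * lam"
definition T :: real where "T = ln (log 2 (2 ^ k) / c)"

text \<open>The potential at the beginning of a visit to the target leaf.\<close>

definition Z :: real where "Z = (T + lam) / D + z"

text \<open>A telescoped sum of tolls \<open>y * \<beta> ^ j * (\<beta> - 1)\<close>: one for each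
  level on the climb to the common ancestor, then one for each level from there down to 1. The
  remainder \<open>y * \<beta>\<close> is left over at the target, together with
  \<open>Z\<close>.\<close>

definition V :: "node \<Rightarrow> real" where
  "V v = y * (\<beta> ^ (lca_level m v + 1) + \<beta> ^ lca_level m v - \<beta> ^ fst v) + Z"

definition good_move :: "node \<Rightarrow> node" where
  "good_move v = (if \<not> in_subtree m v then parent k v
     else if in_subtree m (left_child v) then left_child v else right_child v)"

text \<open>Chernoff bound, given the samples \<open>xs\<close> taken so far from the child \<open>w\<close>, for the probability
  that the sum log-likelihood ratio of all its samples gets the wrong sign.\<close>

definition tail :: "node \<Rightarrow> bool list \<Rightarrow> real" where
  "tail w xs = bhatt (\<mu> (fst w)) ^ (K (fst w + 1) - length xs) *
     exp ((if in_subtree m w then - 1 else 1) * sllr (g (fst w)) (f (fst w)) xs / 2)"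

text \<open>Samples still due, plus the value after a correct move, plus the Chernoff bound for an
  error weighted by the largest excess of any neighbour over the correct one
  (\<open>V_neighbour_le\<close>).\<close>

definition internal_pot :: "node \<Rightarrow> bool list \<Rightarrow> real" where
  "internal_pot v ys = 2 * real (K (fst v)) - real (length ys) + V (good_move v)
     + y * \<beta> ^ fst v * (\<beta>\<^sup>2 + 1) *
       (tail (left_child v) (take (K (fst v)) ys) + tail (right_child v) (drop (K (fst v)) ys))"

text \<open>The exponential terms are likelihood ratio martingales; the one at a wrong leaf pays for the
  error.\<close>

definition target_leaf_pot :: "real \<Rightarrow> real" where
  "target_leaf_pot s = (T + lam - s) / D + z * exp (- s)"

definition wrong_leaf_pot :: "node \<Rightarrow> real \<Rightarrow> real" where
  "wrong_leaf_pot v s = V (parent k v) + (s + lam) / D + exp s"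

fun pot :: "node \<times> bool list \<Rightarrow> real" where
  "pot (v, ys) = (if fst v > 0 then internal_pot v ys
     else if in_subtree m v then target_leaf_pot (leaf_sllr ys)
     else wrong_leaf_pot v (leaf_sllr ys))"

text \<open>The threshold \<open>T\<close> is overshot by at most one step, hence
  \<open>T + lam\<close>; this bound keeps the linear part of \<open>target_leaf_pot\<close>
  nonnegative.\<close>

fun valid_state :: "node \<times> bool list \<Rightarrow> bool" where
  "valid_state (v, ys) \<longleftrightarrow> v \<in> tree_nodes k \<and>
     (if fst v > 0 then length ys < 2 * K (fst v) else 0 \<le> leaf_sllr ys \<and> leaf_sllr ys \<le> T + lam)"

definition success_prob :: "node \<Rightarrow> real" where
  "success_prob w = (if in_subtree m w then 1 - \<mu> (fst w) else \<mu> (fst w))"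

definition obs_mean :: "node \<Rightarrow> (bool \<Rightarrow> real) \<Rightarrow> real" where
  "obs_mean w \<phi> = success_prob w * \<phi> True + (1 - success_prob w) * \<phi> False"

lemma mu_less_1: "\<mu> l < 1"
  using mu_less[of l] by simp

lemmas mu01 = mu_pos mu_less_1

lemma lam_pos: "0 < lam"
  unfolding lam_def by (rule bern_llr_pos[OF mu_pos mu_less])

lemma D_pos: "0 < D"
  using lam_pos mu_less[of 0] by (simp add: D_def)

lemma exp_T: "exp T = k / c"
  using k_pos c_pos by (simp add: T_def)

lemma T_pos: "0 < T"
  using k_pos c_pos c_less by (simp add: T_def)

lemma Z_nonneg: "0 \<le> Z"
  using T_pos lam_pos D_pos z_nonneg by (simp add: Z_def)

lemma V_nonneg: "0 \<le> V v"
proof -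
  have "\<beta> ^ fst v \<le> \<beta> ^ lca_level m v" "0 \<le> \<beta> ^ (lca_level m v + 1)"
    using beta fst_le_lca_level by (auto intro: power_increasing)
  then show ?thesis using y_nonneg Z_nonneg by (auto simp: V_def intro!: mult_nonneg_nonneg)
qed

lemma bhatt_mu_nonneg: "0 \<le> bhatt (\<mu> l)"
  using mu01[of l] by (simp add: bhatt_nonneg)

lemma tail_nonneg: "0 \<le> tail w xs"
  by (simp add: tail_def bhatt_mu_nonneg)

text \<open>Off the target path the climb keeps the common ancestor, so only the term
  \<open>- \<beta> ^ fst v\<close> changes.\<close>

lemma V_parent:
  assumes "v \<in> tree_nodes k" "\<not> in_subtree m v"
  shows "V (parent k v) = V v - y * \<beta> ^ fst v * (\<beta> - 1)"
proof -
  have "v \<noteq> root_node k" using assms(2) root_in_subtree[OF m_less] by blast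
  then show ?thesis
    using lca_level_parent[OF assms(1) m_less assms(2)]
    by (simp add: V_def parent_def algebra_simps)
qed

lemma V_in_subtree: "in_subtree m v \<Longrightarrow> V v = y * \<beta> ^ (fst v + 1) + Z"
  by (simp add: V_def lca_level_in_subtree)

lemma V_wrong_child:
  assumes "v \<in> tree_nodes k" "fst v > 0" "w = left_child v \<or> w = right_child v" "\<not> in_subtree m w"
  shows "V w = V v + y * \<beta> ^ (fst v - 1) * (\<beta> - 1)"
proof -
  have w: "w \<in> tree_nodes k" "parent k w = v" "fst w = fst v - 1"
    using assms(3) child_in_tree[OF assms(1,2)] parent_child[OF assms(1,2)] by auto
  show ?thesis using V_parent[OF w(1) assms(4)] w by simp
qed

text \<open>\<open>V\<close> is balanced so that climbing off the target path and descending along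
  it release the same toll.\<close>

lemma V_good_move:
  assumes "v \<in> tree_nodes k" "fst v > 0"
  shows "V (good_move v) = V v - y * \<beta> ^ fst v * (\<beta> - 1)"
proof (cases "in_subtree m v")
  case True
  then have "in_subtree m (good_move v)" "fst (good_move v) = fst v - 1"
    using in_subtree_children(1)[OF assms(2) True] by (auto simp: good_move_def)
  then show ?thesis
    using True assms(2) by (simp add: V_in_subtree algebra_simps)
next
  case False
  then show ?thesis using V_parent[OF assms(1)] by (simp add: good_move_def)
qed

lemma V_neighbour_le:
  assumes v: "v \<in> tree_nodes k" "fst v > 0" and w: "w \<in> {parent k v, left_child v, right_child v}"
  shows "V w \<le> V (good_move v) + y * \<beta> ^ fst v * (\<beta>\<^sup>2 + 1)"
proof -
  obtain j where j: "fst v = Suc j" using v(2) by (cases "fst v") auto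
  define t where "t = y * \<beta> ^ j"
  have t: "0 \<le> t" using y_nonneg beta by (simp add: t_def)
  \<comment> \<open>A common bound for the worst cases: climbing away from the target raises
    \<open>V\<close> by \<open>t * \<beta>\<^sup>2 * (\<beta> - 1)\<close>, entering a wrong child
    by \<open>t * (\<beta> - 1)\<close>. Adding the release
    \<open>t * \<beta> * (\<beta> - 1)\<close> of the good move turns the factor into
    \<open>\<beta> * (\<beta>\<^sup>2 + 1)\<close>.\<close>
  have "V w \<le> V v + t * (\<beta> * (\<beta>\<^sup>2 - \<beta> + 2))"
  proof (cases "w = parent k v")
    case True
    have "V w \<le> V v + t * (\<beta> * (\<beta>\<^sup>2 - \<beta>))"
    proof -
      have nonneg: "0 \<le> t * (\<beta> * (\<beta>\<^sup>2 - \<beta>))"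
        using t beta by (simp add: power2_eq_square)
      show ?thesis
      proof (cases "in_subtree m v \<and> v \<noteq> root_node k")
        case sub: True
        then have "in_subtree m w" "fst w = Suc (fst v)"
          using \<open>w = parent k v\<close>
          by (auto simp: parent_def in_subtree_def div_mult2_eq mult.commute[of 2])
        then have "V w - V v = t * \<beta> * \<beta> * (\<beta> - 1)"
          using sub by (simp add: V_in_subtree j t_def algebra_simps)
        then show ?thesis by (simp add: power2_eq_square algebra_simps)
      next
        case False
        have "V w \<le> V v"
        proof (cases "v = root_node k")
          case True
          then show ?thesis using \<open>w = parent k v\<close> by (simp add: parent_def)
        next
          case not_root: False
          then show ?thesis
            using False V_parent[OF v(1)] \<open>w = parent k v\<close> y_nonneg beta by simp
        qed
        then show ?thesis using nonneg by simp
      qed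
    qed
    also have "\<dots> \<le> V v + t * (\<beta> * (\<beta>\<^sup>2 - \<beta> + 2))"
      using t beta by (intro add_left_mono mult_left_mono) auto
    finally show ?thesis .
  next
    case False
    then have child: "w = left_child v \<or> w = right_child v" using w by auto
    have "V w \<le> V v + t * (\<beta> - 1)"
    proof (cases "in_subtree m w")
      case True
      then have "in_subtree m v" using child in_subtree_children(2,3)[OF v(2)] by blast
      moreover have "fst w = j" using child j by auto
      ultimately have "V w - V v = - (t * \<beta> * (\<beta> - 1))"
        using True by (simp add: V_in_subtree j t_def algebra_simps)
      moreover have "0 \<le> t * \<beta> * (\<beta> - 1)" "0 \<le> t * (\<beta> - 1)" using t beta by simp_all
      ultimately show ?thesis by linarith
    next
      case False
      then show ?thesis using V_wrong_child[OF v child] by (simp add: j t_def)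
    qed
    also have "\<dots> \<le> V v + t * (\<beta> * (\<beta>\<^sup>2 - \<beta> + 2))"
    proof -
      have "0 \<le> \<beta> * (\<beta> - 1)\<^sup>2" using beta by simp
      then have "\<beta> - 1 \<le> \<beta> * (\<beta>\<^sup>2 - \<beta> + 2)"
        using beta mult_strict_mono[of 1 \<beta> 1 \<beta>] by (simp add: power2_eq_square algebra_simps)
      then show ?thesis using t by (intro add_left_mono mult_left_mono)
    qed
    finally show ?thesis .
  qed
  also have "\<dots> = V (good_move v) + y * \<beta> ^ fst v * (\<beta>\<^sup>2 + 1)"
    unfolding V_good_move[OF v] by (simp add: j t_def algebra_simps)
  finally show ?thesis .
qed

text \<open>The toll in \<open>V v\<close> pays for opening the visit. At the target leaf the
  opening value is \<open>Z\<close> itself; at a wrong leaf it exceeds \<open>V (parent k v)\<close>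
  by \<open>lam / D + 1\<close>.\<close>

lemma pot_fresh_le_V:
  assumes "v \<in> tree_nodes k"
  shows "pot (v, []) \<le> V v"
proof (cases "fst v > 0")
  case True
  have "pot (v, []) = 2 * real (K (fst v)) + 2 * (y * \<beta> ^ fst v * (\<beta>\<^sup>2 + 1)) * bhatt (\<mu> (fst v - 1)) ^ K (fst v)
      + V (good_move v)"
    using True by (simp add: internal_pot_def tail_def)
  also have "\<dots> \<le> V v"
    using internal_bound[of "fst v"] True V_good_move[OF assms True] by simp
  finally show ?thesis .
next
  case leaf: False
  show ?thesis
  proof (cases "in_subtree m v")
    case True
    then show ?thesis
      using leaf y_nonneg beta by (simp add: target_leaf_pot_def V_in_subtree Z_def)
  next
    case False
    have "lam / D = 1 / (1 - 2 * \<mu> 0)" using lam_pos by (simp add: D_def)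
    then show ?thesis
      using leaf False wrong_leaf_bound V_parent[OF assms False]
      by (simp add: wrong_leaf_pot_def)
  qed
qed

text \<open>If both signs are correct the move is the good one, ties being excluded by strictness.
  Otherwise one of the two exponentials is at least 1 and pays for the worst neighbour.\<close>

lemma move_le_internal_pot:
  assumes v: "v \<in> tree_nodes k" "fst v > 0" and len: "length ys = 2 * K (fst v)"
  shows "V (irw_move g f k K tie v ys) \<le> internal_pot v ys"
proof -
  let ?mv = "irw_move g f k K tie v ys"
  define sgn where "sgn w = (if in_subtree m w then - 1 else 1 :: real)" for w
  define L where "L = sllr (g (fst v - 1)) (f (fst v - 1))"
  define a b where "a = L (take (K (fst v)) ys)" and "b = L (drop (K (fst v)) ys)"
  let ?tails = "exp (sgn (left_child v) * a / 2) + exp (sgn (right_child v) * b / 2)"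
  \<comment> \<open>With all samples taken, the count of samples due is 0 and no Bhattacharyya
    factor is pending.\<close>
  have pot: "internal_pot v ys = V (good_move v) + y * \<beta> ^ fst v * (\<beta>\<^sup>2 + 1) * ?tails"
    using v(2) len by (simp add: internal_pot_def tail_def sgn_def L_def a_def b_def)
  have mv: "?mv = (if a < 0 \<and> b < 0 then parent k v
      else if a > b \<or> a = b \<and> tie v then left_child v else right_child v)"
    by (simp add: irw_move_def a_def b_def L_def Let_def)
  have coeff: "0 \<le> y * \<beta> ^ fst v * (\<beta>\<^sup>2 + 1)" using y_nonneg beta by simp
  show ?thesis
  proof (cases "sgn (left_child v) * a < 0 \<and> sgn (right_child v) * b < 0")
    case True
    then have "?mv = good_move v"
      using in_subtree_children[OF v(2), of m] unfolding mv good_move_def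
      by (auto simp: sgn_def split: if_splits)
    moreover have "0 \<le> y * \<beta> ^ fst v * (\<beta>\<^sup>2 + 1) * ?tails"
      by (rule mult_nonneg_nonneg[OF coeff]) (simp add: add_nonneg_nonneg)
    ultimately show ?thesis using pot by simp
  next
    case False
    then have "1 \<le> exp (sgn (left_child v) * a / 2) \<or> 1 \<le> exp (sgn (right_child v) * b / 2)"
      by auto
    then have "1 \<le> ?tails"
      using exp_ge_zero[of "sgn (left_child v) * a / 2"] exp_ge_zero[of "sgn (right_child v) * b / 2"] by linarith
    then have "y * \<beta> ^ fst v * (\<beta>\<^sup>2 + 1) * 1 \<le> y * \<beta> ^ fst v * (\<beta>\<^sup>2 + 1) * ?tails"
      using coeff by (rule mult_left_mono)
    then show ?thesis
      using V_neighbour_le[OF v irw_move_cases[of g f k K tie v ys]] pot by simp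
  qed
qed

section \<open>One-step drift inside a visit, and the end of a visit\<close>

lemma success_prob_bounds: "0 < success_prob w" "success_prob w < 1"
  using mu01[of "fst w"] by (auto simp: success_prob_def)

lemma obs_pmf_eq: "obs_pmf g f m w = bernoulli_pmf (success_prob w)"
  by (simp add: obs_pmf_def success_prob_def)

lemma obs_mean_mono: "(\<And>b. \<phi> b \<le> \<psi> b) \<Longrightarrow> obs_mean w \<phi> \<le> obs_mean w \<psi>"
  using success_prob_bounds[of w] by (simp add: obs_mean_def add_mono)

text \<open>Martingale property: each sample trades a pending factor \<open>bhatt u\<close> for a
  tilted increment whose mean is that factor.\<close>

lemma obs_mean_tail:
  assumes "length xs < K (fst w + 1)"
  shows "obs_mean w (\<lambda>b. tail w (xs @ [b])) = tail w xs"
proof -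
  define u where "u = \<mu> (fst w)"
  define s where "s = (if in_subtree m w then - 1 else 1 :: real)"
  have u: "0 < u" "u < 1" using mu01[of "fst w"] by (simp_all add: u_def)
  have s: "s = 1 \<and> success_prob w = u \<or> s = - 1 \<and> success_prob w = 1 - u"
    by (simp add: s_def u_def success_prob_def)
  define R where "R = bhatt u ^ (K (fst w + 1) - Suc (length xs))"
  define E where "E = exp (s * sllr (bernoulli_pmf (1 - u)) (bernoulli_pmf u) xs / 2)"
  have snoc: "tail w (xs @ [b]) = R * E * exp ((if b then s else - s) * bern_llr u / 2)" for b
  proof -
    have "exp (s * sllr (bernoulli_pmf (1 - u)) (bernoulli_pmf u) (xs @ [b]) / 2)
        = E * exp ((if b then s else - s) * bern_llr u / 2)"
      unfolding sllr_bernoulli_snoc[OF u] E_def mult_exp_exp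
      by (rule arg_cong[of _ _ exp]) (simp add: field_simps)
    then show ?thesis by (simp add: tail_def R_def flip: u_def s_def)
  qed
  have "obs_mean w (\<lambda>b. tail w (xs @ [b]))
      = R * E * (success_prob w * exp (s * bern_llr u / 2) + (1 - success_prob w) * exp (- s * bern_llr u / 2))"
    unfolding obs_mean_def snoc by (simp add: algebra_simps)
  also have "\<dots> = bhatt u ^ Suc (K (fst w + 1) - Suc (length xs)) * E"
    unfolding bhatt_tilt[OF u s] by (simp add: R_def)
  also have "Suc (K (fst w + 1) - Suc (length xs)) = K (fst w + 1) - length xs"
    using assms by simp
  finally show ?thesis by (simp add: tail_def E_def u_def s_def)
qed

lemma obs_mean_affine: "obs_mean w (\<lambda>b. A + B * \<phi> b) = A + B * obs_mean w \<phi>"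
  by (simp add: obs_mean_def algebra_simps)

lemma internal_drift:
  assumes v: "v \<in> tree_nodes k" "fst v > 0" and len: "length ys < 2 * K (fst v)"
  defines "w \<equiv> (if length ys < K (fst v) then left_child v else right_child v)"
  shows "1 + obs_mean w (\<lambda>b. internal_pot v (ys @ [b])) = internal_pot v ys"
proof (cases "length ys < K (fst v)")
  case True
  define C where "C = y * \<beta> ^ fst v * (\<beta>\<^sup>2 + 1)"
  have "internal_pot v (ys @ [b]) = (2 * real (K (fst v)) - real (length ys) - 1 + V (good_move v)
      + C * tail (right_child v) []) + C * tail (left_child v) (ys @ [b])" for b
    using True by (simp add: internal_pot_def C_def algebra_simps)
  then have "1 + obs_mean w (\<lambda>b. internal_pot v (ys @ [b]))
      = 2 * real (K (fst v)) - real (length ys) + V (good_move v)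
      + C * tail (right_child v) [] + C * tail (left_child v) ys"
    using obs_mean_tail[of ys "left_child v"] True v(2) by (simp add: obs_mean_affine w_def)
  also have "\<dots> = internal_pot v ys"
    using True by (simp add: internal_pot_def C_def algebra_simps)
  finally show ?thesis .
next
  case False
  define C where "C = y * \<beta> ^ fst v * (\<beta>\<^sup>2 + 1)"
  have "internal_pot v (ys @ [b]) = (2 * real (K (fst v)) - real (length ys) - 1 + V (good_move v)
      + C * tail (left_child v) (take (K (fst v)) ys)) + C * tail (right_child v) (drop (K (fst v)) ys @ [b])" for b
    using False by (simp add: internal_pot_def C_def algebra_simps)
  then have "1 + obs_mean w (\<lambda>b. internal_pot v (ys @ [b]))
      = 2 * real (K (fst v)) - real (length ys) + V (good_move v)
      + C * tail (left_child v) (take (K (fst v)) ys) + C * tail (right_child v) (drop (K (fst v)) ys)"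
    using obs_mean_tail[of "drop (K (fst v)) ys" "right_child v"] False v(2) len
    by (simp add: obs_mean_affine w_def)
  also have "\<dots> = internal_pot v ys"
    by (simp add: internal_pot_def C_def algebra_simps)
  finally show ?thesis .
qed

lemma exp_lam: "exp lam = (1 - \<mu> 0) / \<mu> 0" "exp (- lam) = \<mu> 0 / (1 - \<mu> 0)"
  using exp_bern_llr[OF mu01] by (simp_all add: lam_def exp_minus)

text \<open>The increment has mean \<open>D\<close> here, so the linear term loses exactly 1, while
  \<open>exp (- s)\<close> is the inverse likelihood ratio and keeps its mean.\<close>

lemma target_leaf_drift:
  assumes "fst v = 0" "in_subtree m v"
  shows "1 + obs_mean v (\<lambda>b. target_leaf_pot (s + (if b then lam else - lam))) = target_leaf_pot s"
proof -
  have p: "success_prob v = 1 - \<mu> 0" using assms by (simp add: success_prob_def)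
  have "(1 - \<mu> 0) * exp (- (s + lam)) + \<mu> 0 * exp (- (s - lam))
      = exp (- s) * ((1 - \<mu> 0) * exp (- lam) + \<mu> 0 * exp lam)"
    by (simp add: distrib_left mult_exp_exp mult.left_commute[of "exp (- s)"])
  also have "(1 - \<mu> 0) * exp (- lam) + \<mu> 0 * exp lam = 1"
    using mu01[of 0] unfolding exp_lam by simp
  finally have e: "(1 - \<mu> 0) * exp (- (s + lam)) + \<mu> 0 * exp (- (s - lam)) = exp (- s)" by simp
  have "(1 - \<mu> 0) * ((T + lam - (s + lam)) / D) + \<mu> 0 * ((T + lam - (s - lam)) / D)
      = (T + lam - s) / D - (1 - 2 * \<mu> 0) * lam / D"
    by (simp add: add_divide_distrib diff_divide_distrib algebra_simps)
  also have "(1 - 2 * \<mu> 0) * lam / D = 1" using D_pos by (simp flip: D_def)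
  finally have l: "(1 - \<mu> 0) * ((T + lam - (s + lam)) / D) + \<mu> 0 * ((T + lam - (s - lam)) / D)
      = (T + lam - s) / D - 1" .
  have "obs_mean v (\<lambda>b. target_leaf_pot (s + (if b then lam else - lam)))
      = ((1 - \<mu> 0) * ((T + lam - (s + lam)) / D) + \<mu> 0 * ((T + lam - (s - lam)) / D))
      + z * ((1 - \<mu> 0) * exp (- (s + lam)) + \<mu> 0 * exp (- (s - lam)))"
    unfolding obs_mean_def p target_leaf_pot_def by (simp add: algebra_simps)
  then show ?thesis unfolding e l by (simp add: target_leaf_pot_def)
qed

lemma wrong_leaf_drift:
  assumes "fst v = 0" "\<not> in_subtree m v"
  shows "1 + obs_mean v (\<lambda>b. wrong_leaf_pot v (s + (if b then lam else - lam))) = wrong_leaf_pot v s"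
proof -
  have p: "success_prob v = \<mu> 0" using assms by (simp add: success_prob_def)
  have "\<mu> 0 * exp (s + lam) + (1 - \<mu> 0) * exp (s - lam)
      = exp s * (\<mu> 0 * exp lam + (1 - \<mu> 0) * exp (- lam))"
    by (simp add: distrib_left mult_exp_exp mult.left_commute[of "exp s"])
  also have "\<mu> 0 * exp lam + (1 - \<mu> 0) * exp (- lam) = 1"
    using mu01[of 0] unfolding exp_lam by simp
  finally have e: "\<mu> 0 * exp (s + lam) + (1 - \<mu> 0) * exp (s - lam) = exp s" by simp
  have "\<mu> 0 * ((s + lam + lam) / D) + (1 - \<mu> 0) * ((s - lam + lam) / D)
      = (s + lam) / D - (1 - 2 * \<mu> 0) * lam / D"
    by (simp add: add_divide_distrib diff_divide_distrib algebra_simps)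
  also have "(1 - 2 * \<mu> 0) * lam / D = 1" using D_pos by (simp flip: D_def)
  finally have l: "\<mu> 0 * ((s + lam + lam) / D) + (1 - \<mu> 0) * ((s - lam + lam) / D)
      = (s + lam) / D - 1" .
  have "obs_mean v (\<lambda>b. wrong_leaf_pot v (s + (if b then lam else - lam)))
      = V (parent k v) + (\<mu> 0 * ((s + lam + lam) / D) + (1 - \<mu> 0) * ((s - lam + lam) / D))
      + (\<mu> 0 * exp (s + lam) + (1 - \<mu> 0) * exp (s - lam))"
    unfolding obs_mean_def p wrong_leaf_pot_def by (simp add: algebra_simps)
  then show ?thesis unfolding e l by (simp add: wrong_leaf_pot_def)
qed

lemma leaf_sllr_snoc: "leaf_sllr (ys @ [b]) = leaf_sllr ys + (if b then lam else - lam)"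
  using sllr_bernoulli_snoc[OF mu01] by (simp add: lam_def)

text \<open>The sum has fallen to at most \<open>- lam\<close>, so the exponential term has gained
  at least \<open>z * (exp lam - 1)\<close> since the start of the visit. That covers
  \<open>V (parent k v) - Z = y * \<beta>\<^sup>2\<close>.\<close>

lemma leave_target_leaf:
  assumes "v \<in> tree_nodes k" "fst v = 0" "in_subtree m v" "leaf_sllr ys < 0"
  shows "V (parent k v) \<le> target_leaf_pot (leaf_sllr ys)"
proof -
  have s: "leaf_sllr ys \<le> - lam"
    unfolding lam_def by (rule sllr_bernoulli_neg_imp_le[OF mu_pos mu_less assms(4)])
  have "v \<noteq> root_node k" using assms(2) k_pos by (auto simp: root_node_def)
  then have "in_subtree m (parent k v)" "fst (parent k v) = 1"
    using assms(2,3) by (auto simp: parent_def in_subtree_def)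
  then have "V (parent k v) = y * \<beta>\<^sup>2 + ((T + lam) / D + z)"
    by (simp add: V_in_subtree Z_def power2_eq_square)
  also have "\<dots> \<le> (T + lam - leaf_sllr ys) / D + z * exp lam"
  proof -
    have "(T + lam) / D \<le> (T + lam - leaf_sllr ys) / D"
      using s lam_pos D_pos by (intro divide_right_mono) auto
    then show ?thesis using target_leaf_bound by (simp add: lam_def algebra_simps)
  qed
  also have "\<dots> \<le> target_leaf_pot (leaf_sllr ys)"
    using s z_nonneg by (auto simp: target_leaf_pot_def intro!: mult_left_mono)
  finally show ?thesis .
qed

text \<open>The shift by \<open>lam\<close> in \<open>wrong_leaf_pot\<close> serves this: one step
  from a nonnegative sum stays at or above \<open>- lam\<close>.\<close>

lemma leave_wrong_leaf:
  assumes "0 \<le> leaf_sllr ys"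
  shows "V (parent k v) \<le> wrong_leaf_pot v (leaf_sllr (ys @ [b]))"
proof -
  have "0 \<le> leaf_sllr (ys @ [b]) + lam"
    using assms lam_pos unfolding leaf_sllr_snoc by simp
  then have "0 \<le> (leaf_sllr (ys @ [b]) + lam) / D" using D_pos by simp
  then show ?thesis
    using exp_ge_zero[of "leaf_sllr (ys @ [b])"] unfolding wrong_leaf_pot_def by linarith
qed

lemma valid_state_fresh: "v \<in> tree_nodes k \<Longrightarrow> valid_state (v, [])"
  using K_pos[of "fst v"] T_pos lam_pos by auto

text \<open>Allows the real-valued drift inequality to be transferred to
  \<open>ennreal\<close>.\<close>

lemma pot_nonneg:
  assumes "valid_state s"
  shows "0 \<le> pot s"
proof -
  obtain v ys where s: "s = (v, ys)" by (cases s)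
  show ?thesis
  proof (cases "fst v > 0")
    case True
    have "0 \<le> y * \<beta> ^ fst v * (\<beta>\<^sup>2 + 1) *
       (tail (left_child v) (take (K (fst v)) ys) + tail (right_child v) (drop (K (fst v)) ys))"
      using y_nonneg beta tail_nonneg by (intro mult_nonneg_nonneg add_nonneg_nonneg) auto
    then show ?thesis
      using True assms V_nonneg[of "good_move v"] by (simp add: s internal_pot_def)
  next
    case False
    then have "0 \<le> leaf_sllr ys" "leaf_sllr ys \<le> T + lam" using assms by (auto simp: s)
    then show ?thesis
      using False V_nonneg[of "parent k v"] D_pos lam_pos z_nonneg
      by (simp add: s target_leaf_pot_def wrong_leaf_pot_def)
  qed
qed

section \<open>The policy as a strategy, and its risk under one hypothesis\<close>

abbreviation \<Gamma> :: "bool strategy" where "\<Gamma> \<equiv> irw g f k K tie c"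
abbreviation state :: "bool history \<Rightarrow> node \<times> bool list" where "state \<equiv> irw_state g f k K tie"
abbreviation step :: "node \<times> bool list \<Rightarrow> bool \<Rightarrow> node \<times> bool list" where
  "step \<equiv> irw_step g f k K tie"

lemma stopping_iff: "state h = (v, ys) \<Longrightarrow> stopping \<Gamma> h \<longleftrightarrow> fst v = 0 \<and> T < leaf_sllr ys"
  by (simp add: irw_def T_def)

lemma selection_eq: "state h = (v, ys) \<Longrightarrow> selection \<Gamma> h =
    (if fst v = 0 then v else if length ys < K (fst v) then left_child v else right_child v)"
  by (simp add: irw_def)

lemma selection_in_tree:
  assumes "valid_state (state h)"
  shows "selection \<Gamma> h \<in> tree_nodes k"
proof -
  obtain v ys where st: "state h = (v, ys)" by (cases "state h")
  then show ?thesis using assms child_in_tree[of v k] by (auto simp: selection_eq)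
qed

lemma valid_state_step:
  assumes "valid_state (v, ys)" "fst v = 0 \<Longrightarrow> leaf_sllr ys \<le> T"
  shows "valid_state (step (v, ys) b)"
proof (cases "fst v > 0")
  case True
  have "v \<in> tree_nodes k" using assms(1) by simp
  then have "valid_state (irw_move g f k K tie v (ys @ [b]), [])"
    by (intro valid_state_fresh irw_move_in_tree True)
  then show ?thesis using True assms(1) by (simp add: Let_def del: valid_state.simps) simp
next
  case False
  have v: "v \<in> tree_nodes k" using assms(1) by simp
  have le: "leaf_sllr (ys @ [b]) \<le> T + lam"
    using assms(2) False lam_pos unfolding leaf_sllr_snoc by simp
  have "step (v, ys) b = (if leaf_sllr (ys @ [b]) < 0 then (parent k v, []) else (v, ys @ [b]))"
    using False by (simp add: Let_def)
  moreover have "valid_state (parent k v, [])"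
    by (intro valid_state_fresh parent_in_tree v)
  moreover have "0 \<le> leaf_sllr (ys @ [b]) \<Longrightarrow> valid_state (v, ys @ [b])"
    using False v le by simp
  ultimately show ?thesis by (auto simp only: not_less split: if_splits)
qed

text \<open>The formula of the current visit has exact unit drift. When a sample ends the visit, the
  fresh potential of the next node is dominated by that same formula at the extended sample list, so
  an inequality remains.\<close>

lemma pot_drift:
  assumes "valid_state (state h)" "\<not> stopping \<Gamma> h"
  shows "1 + obs_mean (selection \<Gamma> h) (\<lambda>b. pot (step (state h) b)) \<le> pot (state h)"
proof -
  obtain v ys where st: "state h = (v, ys)" by (cases "state h")
  have v: "v \<in> tree_nodes k" using assms(1) st by simp
  show ?thesis
  proof (cases "fst v > 0")
    case True
    have len: "length ys < 2 * K (fst v)" using assms(1) st True by simp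
    have le: "pot (step (v, ys) b) \<le> internal_pot v (ys @ [b])" for b
    proof (cases "Suc (length ys) < 2 * K (fst v)")
      case True
      then show ?thesis using \<open>fst v > 0\<close> by (simp add: Let_def)
    next
      case False
      then have "step (v, ys) b = (irw_move g f k K tie v (ys @ [b]), [])"
        using True by (simp add: Let_def)
      moreover have "V (irw_move g f k K tie v (ys @ [b])) \<le> internal_pot v (ys @ [b])"
        using False len by (intro move_le_internal_pot v True) simp
      ultimately show ?thesis
        using pot_fresh_le_V[OF irw_move_in_tree[OF v True, of g f K tie "ys @ [b]"]] by simp
    qed
    have "1 + obs_mean (selection \<Gamma> h) (\<lambda>b. pot (step (v, ys) b))
        \<le> 1 + obs_mean (selection \<Gamma> h) (\<lambda>b. internal_pot v (ys @ [b]))"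
      by (intro add_left_mono obs_mean_mono le)
    also have "\<dots> = internal_pot v ys"
      using internal_drift[OF v True len] True by (simp add: selection_eq[OF st])
    finally show ?thesis using True by (simp add: st)
  next
    case False
    have S: "0 \<le> leaf_sllr ys" using assms(1) st False by simp
    have par: "pot (parent k v, []) \<le> V (parent k v)"
      by (rule pot_fresh_le_V[OF parent_in_tree[OF v]])
    have step: "step (v, ys) b = (if leaf_sllr (ys @ [b]) < 0 then (parent k v, []) else (v, ys @ [b]))" for b
      using False by (simp add: Let_def)
    show ?thesis
    proof (cases "in_subtree m v")
      case True
      have le: "pot (step (v, ys) b) \<le> target_leaf_pot (leaf_sllr (ys @ [b]))" for b
        using leave_target_leaf[OF v _ True, of "ys @ [b]"] par False True unfolding step by auto
      have "1 + obs_mean v (\<lambda>b. pot (step (v, ys) b))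
          \<le> 1 + obs_mean v (\<lambda>b. target_leaf_pot (leaf_sllr (ys @ [b])))"
        by (intro add_left_mono obs_mean_mono le)
      also have "\<dots> = target_leaf_pot (leaf_sllr ys)"
        unfolding leaf_sllr_snoc using target_leaf_drift[OF _ True] False by simp
      finally show ?thesis using False True by (simp add: st selection_eq[OF st])
    next
      case wrong: False
      have le: "pot (step (v, ys) b) \<le> wrong_leaf_pot v (leaf_sllr (ys @ [b]))" for b
        using leave_wrong_leaf[OF S, of v b] par False wrong unfolding step by auto
      have "1 + obs_mean v (\<lambda>b. pot (step (v, ys) b))
          \<le> 1 + obs_mean v (\<lambda>b. wrong_leaf_pot v (leaf_sllr (ys @ [b])))"
        by (intro add_left_mono obs_mean_mono le)
      also have "\<dots> = wrong_leaf_pot v (leaf_sllr ys)"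
        unfolding leaf_sllr_snoc using wrong_leaf_drift[OF _ wrong] False by simp
      finally show ?thesis using False wrong by (simp add: st selection_eq[OF st])
    qed
  qed
qed

lemma pot_at_wrong_declaration:
  assumes "valid_state (state h)" "stopping \<Gamma> h" "decl \<Gamma> h \<noteq> m"
  shows "1 / c \<le> pot (state h)"
proof -
  obtain v ys where st: "state h = (v, ys)" by (cases "state h")
  have leaf: "fst v = 0" "T < leaf_sllr ys" using assms(2) by (auto simp: stopping_iff[OF st])
  have "snd v \<noteq> m" using assms(3) st by (simp add: irw_def)
  then have wrong: "\<not> in_subtree m v" using leaf by (auto simp: in_subtree_def)
  \<comment> \<open>\<open>k / c\<close> is \<open>exp T\<close>, so passing the threshold already
    yields the price of an error.\<close>
  have "1 / c \<le> k / c" using k_pos c_pos by (intro divide_right_mono) auto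
  also have "\<dots> \<le> exp (leaf_sllr ys)" using leaf(2) by (simp flip: exp_T)
  also have "\<dots> \<le> wrong_leaf_pot v (leaf_sllr ys)"
    using V_nonneg[of "parent k v"] leaf T_pos lam_pos D_pos by (simp add: wrong_leaf_pot_def)
  finally show ?thesis using leaf wrong by (simp add: st)
qed

lemma hypothesis_risk_le:
  "emeasure (hyp_space g f k m) {\<omega> \<in> space (hyp_space g f k m). \<not> declares \<Gamma> \<omega> m}
     + ennreal c * (\<integral>\<^sup>+\<omega>. ennreal_of_enat (stop_time \<Gamma> \<omega>) \<partial>hyp_space g f k m)
   \<le> ennreal (c * (y * \<beta> ^ (k + 1) + (T + lam) / D + z))"
proof -
  let ?err = "emeasure (hyp_space g f k m) {\<omega> \<in> space (hyp_space g f k m). \<not> declares \<Gamma> \<omega> m}"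
  let ?time = "\<integral>\<^sup>+\<omega>. ennreal_of_enat (stop_time \<Gamma> \<omega>) \<partial>hyp_space g f k m"
  have root: "root_node k \<in> tree_nodes k" by (simp add: root_node_def tree_nodes_def)
  have next_valid: "valid_state (state (h @ [(selection \<Gamma> h, b)]))"
    if "valid_state (state h)" "\<not> stopping \<Gamma> h" for h b
  proof -
    obtain v ys where st: "state h = (v, ys)" by (cases "state h")
    show ?thesis
      using valid_state_step[of v ys b] that stopping_iff[OF st] st
      by (auto simp del: valid_state.simps irw_step.simps)
  qed
  \<comment> \<open>Risk in units of samples; multiplication by \<open>c\<close> restores the
    weights 1 and \<open>c\<close>.\<close>
  have "ennreal (1 / c) * ?err + ?time \<le> ennreal (pot (state []))"
  proof (rule lyapunov_risk_bound[where valid = "\<lambda>h. valid_state (state h)" and \<Phi> = "\<lambda>h. ennreal (pot (state h))"])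
    fix h assume h: "valid_state (state h)" "\<not> stopping \<Gamma> h"
    have nonneg: "0 \<le> pot (step (state h) b)" for b
      using pot_nonneg[OF next_valid[OF h]] by simp
    have "1 + (\<integral>\<^sup>+b. ennreal (pot (step (state h) b)) \<partial>bernoulli_pmf (success_prob (selection \<Gamma> h)))
        = 1 + ennreal (obs_mean (selection \<Gamma> h) (\<lambda>b. pot (step (state h) b)))"
      using success_prob_bounds[of "selection \<Gamma> h"] nonneg
      by (subst nn_integral_bernoulli_ennreal) (auto simp: obs_mean_def)
    also have "\<dots> = ennreal (1 + obs_mean (selection \<Gamma> h) (\<lambda>b. pot (step (state h) b)))"
      using success_prob_bounds[of "selection \<Gamma> h"] nonneg
      by (subst ennreal_plus) (auto simp: obs_mean_def)
    also have "\<dots> \<le> ennreal (pot (state h))"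
      by (intro ennreal_leI pot_drift h)
    finally show "1 + (\<integral>\<^sup>+b. ennreal (pot (state (h @ [(selection \<Gamma> h, b)])))
        \<partial>obs_pmf g f m (selection \<Gamma> h)) \<le> ennreal (pot (state h))"
      by (simp only: obs_pmf_eq irw_state_snoc)
  qed (use selection_in_tree next_valid pot_at_wrong_declaration valid_state_fresh[OF root]
      in \<open>auto intro!: ennreal_leI simp del: valid_state.simps pot.simps irw_state_snoc\<close>)
  also have "\<dots> \<le> ennreal (y * \<beta> ^ (k + 1) + (T + lam) / D + z)"
    using pot_fresh_le_V[OF root] V_in_subtree[OF root_in_subtree[OF m_less]]
    by (intro ennreal_leI) (simp add: root_node_def Z_def del: pot.simps)
  finally have "ennreal c * (ennreal (1 / c) * ?err + ?time)
      \<le> ennreal c * ennreal (y * \<beta> ^ (k + 1) + (T + lam) / D + z)"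
    by (rule mult_left_mono) simp
  moreover have "ennreal c * (ennreal (1 / c) * ?err + ?time) = ?err + ennreal c * ?time"
  proof -
    have "ennreal c * (ennreal (1 / c) * ?err) = ennreal (c * (1 / c)) * ?err"
      using c_pos by (subst ennreal_mult) (auto simp: mult.assoc)
    then show ?thesis using c_pos by (simp add: distrib_left)
  qed
  moreover have "ennreal c * ennreal (y * \<beta> ^ (k + 1) + (T + lam) / D + z)
      = ennreal (c * (y * \<beta> ^ (k + 1) + (T + lam) / D + z))"
    using c_pos by (simp add: ennreal_mult')
  ultimately show ?thesis by simp
qed

end

subsection \<open>The Bayes risk\<close>

text \<open>A bound uniform in the target survives averaging, since the prior gives the leaves mass
  at most 1.\<close>

lemma bayes_risk_le:
  assumes R: "\<And>m. m < 2 ^ k \<Longrightarrow>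
    emeasure (hyp_space g f k m) {\<omega> \<in> space (hyp_space g f k m). \<not> declares \<Gamma> \<omega> m}
     + ennreal c * (\<integral>\<^sup>+\<omega>. ennreal_of_enat (stop_time \<Gamma> \<omega>) \<partial>hyp_space g f k m) \<le> R"
  shows "bayes_risk g f k prior c \<Gamma> \<le> R"
proof -
  have "bayes_risk g f k prior c \<Gamma>
      = (\<Sum>m<2 ^ k. ennreal (pmf prior m) *
          (emeasure (hyp_space g f k m) {\<omega> \<in> space (hyp_space g f k m). \<not> declares \<Gamma> \<omega> m}
           + ennreal c * (\<integral>\<^sup>+\<omega>. ennreal_of_enat (stop_time \<Gamma> \<omega>) \<partial>hyp_space g f k m)))"
    by (simp add: bayes_risk_def error_prob_def mean_samples_def sum_distrib_left distrib_left
        sum.distrib mult.left_commute)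
  also have "\<dots> \<le> (\<Sum>m<2 ^ k. ennreal (pmf prior m) * R)"
    by (intro sum_mono mult_left_mono R) auto
  also have "\<dots> = ennreal (measure_pmf.prob prior {..<2 ^ k}) * R"
    by (simp add: measure_measure_pmf_finite flip: sum_distrib_right)
  also have "\<dots> \<le> 1 * R"
    by (intro mult_right_mono) auto
  finally show ?thesis by simp
qed

theorem theorem3:
  fixes \<mu> :: "nat \<Rightarrow> real" and \<mu>\<^sub>0 \<alpha> p :: real and f g :: "nat \<Rightarrow> bool pmf"
  assumes "0 < \<mu>\<^sub>0" and "\<mu>\<^sub>0 < 1 / 2" and "\<alpha> > 1"
    and "1 / 2 < p" and "p < 1"
    and "\<And>l. \<mu> l = 1 / 2 - (1 / 2 - \<mu>\<^sub>0) * \<alpha> powi (- int l)"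
    and "\<And>l. f l = bernoulli_pmf (\<mu> l)"
    and "\<And>l. g l = bernoulli_pmf (1 - \<mu> l)"
  shows "\<exists>K :: nat \<Rightarrow> nat.
    (\<forall>l\<ge>1. conf_g (g (l - 1)) (f (l - 1)) (K l) > p \<and>
           conf_f (g (l - 1)) (f (l - 1)) (K l) > p) \<and>
    (\<exists>B C :: real. \<forall>k M :: nat. \<forall>c :: real. \<forall>prior :: nat pmf. \<forall>tie :: node \<Rightarrow> bool.
       k \<ge> 1 \<longrightarrow> M = 2 ^ k \<longrightarrow> 0 < c \<longrightarrow> c < 1 \<longrightarrow> set_pmf prior \<subseteq> {..<M} \<longrightarrow>
       bayes_risk g f k prior c (irw g f k K tie c) \<le>
         ennreal (c * B * real M powr (log 2 (\<alpha>\<^sup>2))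
                  + c * ln (log 2 (real M) / c)
                      / KL_divergence (exp 1) (measure_pmf (f 0)) (measure_pmf (g 0))
                  + C * c))"
proof -
  define \<beta> where "\<beta> = \<alpha>\<^sup>2"
  define \<delta> where "\<delta> = 1 / 2 - \<mu>\<^sub>0"
  have \<beta>: "1 < \<beta>" using assms(3) by (simp add: \<beta>_def)
  have \<delta>: "0 < \<delta>" using assms(2) by (simp add: \<delta>_def)
  have \<mu>: "\<mu> l = 1 / 2 - \<delta> / \<alpha> ^ l" for l
    using assms(6)[of l] by (simp add: \<delta>_def power_int_minus field_simps)
  have \<mu>_less: "\<mu> l < 1 / 2" for l using \<delta> assms(3) by (simp add: \<mu>)
  have \<mu>_pos: "0 < \<mu> l" for l
  proof -
    have "\<delta> / \<alpha> ^ l \<le> \<delta> / 1"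
      using \<delta> assms(3) by (intro divide_left_mono) auto
    then show ?thesis using assms(1) \<mu>[of l] \<delta>_def by linarith
  qed
  have \<mu>01: "0 < \<mu> l" "\<mu> l < 1" for l using \<mu>_pos[of l] \<mu>_less[of l] by simp_all
  have fg: "f = (\<lambda>l. bernoulli_pmf (\<mu> l))" "g = (\<lambda>l. bernoulli_pmf (1 - \<mu> l))"
    using assms(7,8) by (simp_all add: fun_eq_iff)

  text \<open>A wrong move may raise the potential by a factor of about \<open>\<beta>\<close>, so the error probability
    has to be small in terms of \<open>\<beta>\<close> as well.\<close>
  define \<epsilon> where "\<epsilon> = min ((1 - p) / 4) ((\<beta> - 1) / (4 * (\<beta>\<^sup>2 + 1)))"
  \<comment> \<open>Chosen so that
    \<open>exp (- 2 * \<delta>\<^sup>2 * \<kappa>) = \<epsilon>\<close>. The squared bias at level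
    \<open>j\<close> is \<open>\<delta>\<^sup>2 / \<beta> ^ j\<close>, so a sample size proportional
    to \<open>\<beta> ^ l\<close> offsets it for the children at level \<open>l - 1\<close>.\<close>
  define \<kappa> where "\<kappa> = ln (1 / \<epsilon>) / (2 * \<delta>\<^sup>2)"
  define K where "K l = nat \<lceil>\<kappa> * \<beta> ^ l\<rceil>" for l
  have \<epsilon>: "0 < \<epsilon>" "\<epsilon> < 1" "4 * \<epsilon> \<le> 1 - p"
  proof -
    show "0 < \<epsilon>" using \<beta> assms(5) by (simp add: \<epsilon>_def add_nonneg_pos)
    have "\<epsilon> \<le> (1 - p) / 4" unfolding \<epsilon>_def by (rule min.cobounded1)
    with assms(4) show "\<epsilon> < 1" "4 * \<epsilon> \<le> 1 - p" by simp_all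
  qed
  have \<epsilon>_\<beta>: "2 * (\<beta>\<^sup>2 + 1) * \<epsilon> \<le> (\<beta> - 1) / 2"
  proof -
    have "\<epsilon> \<le> (\<beta> - 1) / (4 * (\<beta>\<^sup>2 + 1))" unfolding \<epsilon>_def by (rule min.cobounded2)
    moreover have "0 < 4 * (\<beta>\<^sup>2 + 1)" by (simp add: add_nonneg_pos)
    ultimately have "\<epsilon> * (4 * (\<beta>\<^sup>2 + 1)) \<le> \<beta> - 1" by (simp only: pos_le_divide_eq)
    then show ?thesis by (simp add: algebra_simps)
  qed
  have \<kappa>: "0 < \<kappa>" using \<epsilon> \<delta> by (simp add: \<kappa>_def)
  have K_ge: "\<kappa> * \<beta> ^ l \<le> K l" and K_le: "K l \<le> (\<kappa> + 1) * \<beta> ^ l" for l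
  proof -
    have "0 < \<kappa> * \<beta> ^ l" "1 \<le> \<beta> ^ l" using \<kappa> \<beta> by simp_all
    then have "\<kappa> * \<beta> ^ l \<le> K l \<and> K l \<le> \<kappa> * \<beta> ^ l + 1 * \<beta> ^ l"
      unfolding K_def by linarith
    then show "\<kappa> * \<beta> ^ l \<le> K l" "K l \<le> (\<kappa> + 1) * \<beta> ^ l"
      by (simp_all add: distrib_right)
  qed
  have bhatt: "bhatt (\<mu> (l - 1)) ^ K l \<le> \<epsilon>" if "1 \<le> l" for l
  proof -
    have "\<kappa> \<le> real (K l) / \<beta> ^ (l - 1)"
    proof -
      have "\<kappa> * \<beta> ^ (l - 1) \<le> \<kappa> * \<beta> ^ l" using \<kappa> \<beta> by (simp add: power_increasing)
      also have "\<dots> \<le> K l" by (rule K_ge)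
      finally show ?thesis using \<beta> by (simp add: pos_le_divide_eq)
    qed
    then have "2 * \<delta>\<^sup>2 * \<kappa> \<le> 2 * \<delta>\<^sup>2 * (real (K l) / \<beta> ^ (l - 1))"
      by (rule mult_left_mono) simp
    moreover have "2 * \<delta>\<^sup>2 * \<kappa> = - ln \<epsilon>"
      using \<delta> \<epsilon> by (simp add: \<kappa>_def ln_div)
    ultimately have "real (K l) * (- 2 * (1 / 2 - \<mu> (l - 1))\<^sup>2) \<le> ln \<epsilon>"
      by (simp add: \<mu> \<beta>_def power_divide power_mult[symmetric] mult.commute)
    then have "exp (real (K l) * (- 2 * (1 / 2 - \<mu> (l - 1))\<^sup>2)) \<le> \<epsilon>"
      using \<epsilon>(1) by (metis exp_le_cancel_iff exp_ln)
    moreover have "bhatt (\<mu> (l - 1)) ^ K l \<le> exp (- 2 * (1 / 2 - \<mu> (l - 1))\<^sup>2) ^ K l"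
      using \<mu>01[of "l - 1"] by (intro power_mono bhatt_le_exp bhatt_nonneg) auto
    ultimately show ?thesis unfolding exp_of_nat_mult by linarith
  qed

  \<comment> \<open>The first entry makes half of the toll cover \<open>2 * K l\<close>;
    \<open>\<epsilon>_\<beta>\<close> makes the other half cover the errors. The second entry is the
    demand of the wrong leaves.\<close>
  define y where "y = max (4 * (\<kappa> + 1)) (1 / (1 - 2 * \<mu> 0) + 1) / (\<beta> - 1)"
  have y: "4 * (\<kappa> + 1) \<le> y * (\<beta> - 1)" "1 / (1 - 2 * \<mu> 0) + 1 \<le> y * (\<beta> - 1)"
    using \<beta> by (simp_all add: y_def)
  have y_nonneg: "0 \<le> y" using \<kappa> \<beta> by (simp add: y_def le_max_iff_disj)
  define lam where "lam = bern_llr (\<mu> 0)"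
  define D where "D = (1 - 2 * \<mu> 0) * lam"
  have lam: "0 < lam" unfolding lam_def by (rule bern_llr_pos[OF \<mu>_pos \<mu>_less])
  define z where "z = y * \<beta>\<^sup>2 / (exp lam - 1)"
  have z: "0 \<le> z" "y * \<beta>\<^sup>2 \<le> z * (exp lam - 1)"
    using lam y_nonneg by (simp_all add: z_def)

  have internal: "2 * real (K l) + 2 * (y * \<beta> ^ l * (\<beta>\<^sup>2 + 1)) * bhatt (\<mu> (l - 1)) ^ K l
      \<le> y * \<beta> ^ l * (\<beta> - 1)" if "1 \<le> l" for l
  proof -
    have "2 * real (K l) \<le> (2 * (\<kappa> + 1)) * \<beta> ^ l"
      using K_le[of l] by (simp add: distrib_right)
    also have "\<dots> \<le> (y * (\<beta> - 1) / 2) * \<beta> ^ l"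
      using y(1) \<beta> by (intro mult_right_mono) auto
    finally have "2 * real (K l) \<le> (y * (\<beta> - 1) / 2) * \<beta> ^ l" .
    moreover have "2 * (y * \<beta> ^ l * (\<beta>\<^sup>2 + 1)) * bhatt (\<mu> (l - 1)) ^ K l \<le> (y * \<beta> ^ l) * ((\<beta> - 1) / 2)"
    proof -
      have "2 * (y * \<beta> ^ l * (\<beta>\<^sup>2 + 1)) * bhatt (\<mu> (l - 1)) ^ K l
          \<le> 2 * (y * \<beta> ^ l * (\<beta>\<^sup>2 + 1)) * \<epsilon>"
        using y_nonneg \<beta> by (intro mult_left_mono bhatt that) simp
      also have "\<dots> = (y * \<beta> ^ l) * (2 * (\<beta>\<^sup>2 + 1) * \<epsilon>)" by simp
      also have "\<dots> \<le> (y * \<beta> ^ l) * ((\<beta> - 1) / 2)"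
        using y_nonneg \<beta> by (intro mult_left_mono \<epsilon>_\<beta>) simp
      finally show ?thesis .
    qed
    ultimately show ?thesis by (simp add: field_simps)
  qed

  \<comment> \<open>Both levels are at least
    \<open>1 - 2 * \<epsilon> \<ge> 1 - (1 - p) / 2 > p\<close>.\<close>
  have conf: "p < conf_g (g (l - 1)) (f (l - 1)) (K l)" "p < conf_f (g (l - 1)) (f (l - 1)) (K l)"
    if "1 \<le> l" for l
    using conf_g_ge[OF \<mu>01, of "l - 1" "K l"] conf_f_ge[OF \<mu>01, of "l - 1" "K l"] bhatt[OF that] \<epsilon>
    unfolding fg by auto

  have risk: "bayes_risk g f k prior c (irw g f k K tie c) \<le>
      ennreal (c * (y * \<beta>) * real M powr (log 2 (\<alpha>\<^sup>2)) + c * ln (log 2 (real M) / c)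
        / KL_divergence (exp 1) (measure_pmf (f 0)) (measure_pmf (g 0)) + (lam / D + z) * c)"
    if "1 \<le> k" "M = 2 ^ k" "0 < c" "c < 1" for k M c tie and prior :: "nat pmf"
  proof (rule bayes_risk_le)
    fix m :: nat assume "m < 2 ^ k"
    then interpret irw: irw_bernoulli \<mu> K \<beta> y z c k m tie
    proof unfold_locales
      show "0 < K l" if "1 \<le> l" for l
      proof -
        have "0 < \<kappa> * \<beta> ^ l" using \<kappa> \<beta> by simp
        also have "\<dots> \<le> K l" by (rule K_ge)
        finally show ?thesis by simp
      qed
    qed (use \<mu>_pos \<mu>_less \<beta> y_nonneg z that internal y(2) in \<open>auto simp: lam_def\<close>)
    have "real M powr (log 2 (\<alpha>\<^sup>2)) = \<beta> ^ k"
    proof -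
      have "real M powr (log 2 (\<alpha>\<^sup>2)) = (2 powr log 2 \<beta>) powr real k"
        unfolding powr_powr by (simp add: that(2) powr_powr mult.commute flip: powr_realpow \<beta>_def)
      then show ?thesis using \<beta> by (simp add: powr_realpow)
    qed
    moreover have "KL_divergence (exp 1) (measure_pmf (f 0)) (measure_pmf (g 0)) = D"
      using KL_bernoulli[OF \<mu>01] by (simp add: fg D_def lam_def)
    moreover have "irw.T = ln (log 2 (real M) / c)" "irw.D = D" "irw.lam = lam"
      by (simp_all add: irw.T_def irw.D_def irw.lam_def D_def lam_def that(2))
    \<comment> \<open>One factor \<beta> goes into the constant \<open>y * \<beta>\<close>, and the
      overshoot \<open>lam / D\<close> joins \<open>z\<close> in the O(c) term. None of
      \<open>y\<close>, \<open>z\<close>, \<open>lam\<close>, \<open>D\<close> depends on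
      \<open>k\<close> or \<open>c\<close>.\<close>
    ultimately have "c * (y * \<beta> ^ (k + 1) + (irw.T + irw.lam) / irw.D + z)
      = c * (y * \<beta>) * real M powr (log 2 (\<alpha>\<^sup>2)) + c * ln (log 2 (real M) / c)
        / KL_divergence (exp 1) (measure_pmf (f 0)) (measure_pmf (g 0)) + (lam / D + z) * c"
      by (simp add: algebra_simps add_divide_distrib)
    then show "emeasure (hyp_space g f k m)
          {\<omega> \<in> space (hyp_space g f k m). \<not> declares (irw g f k K tie c) \<omega> m}
        + ennreal c * (\<integral>\<^sup>+\<omega>. ennreal_of_enat (stop_time (irw g f k K tie c) \<omega>) \<partial>hyp_space g f k m)
      \<le> ennreal (c * (y * \<beta>) * real M powr (log 2 (\<alpha>\<^sup>2)) + c * ln (log 2 (real M) / c)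
        / KL_divergence (exp 1) (measure_pmf (f 0)) (measure_pmf (g 0)) + (lam / D + z) * c)"
      using irw.hypothesis_risk_le unfolding fg by simp
  qed
  show ?thesis
    by (rule exI[of _ K], intro conjI exI[of _ "y * \<beta>"] exI[of _ "lam / D + z"])
      (use conf risk in auto)
qed

end
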